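(* Let $\mathcal{P}$ be one of the following finite classical polar spaces of rank $d$: $Q^+(2d-1,q)$ with $d$ odd, $Q(2d,q)$ with $d$ odd, $W(2d-1,q)$ with $d$ odd, $H(2d,q)$ ($q$ a square), or $Q^-(2d+1,q)$. Let $n$ be the number of generators of $\mathcal{P}$, and let $b=n/2$ if $\mathcal{P}=Q^+(2d-1,q)$, and let $b$ be the number of generators of $\mathcal{P}$ containing a fixed point otherwise. If $(Y,Z)$ is a cross-intersecting EKR set of generators of $\mathcal{P}$ with $\sqrt{|Y|\cdot|Z|}=b$, then $Y=Z$, and $Y$ is an EKR set.
   Context: All dimensions are vector space dimensions. $Q^+(2d-1,q)$, $Q(2d,q)$, $Q^-(2d+1,q)$, $W(2d-1,q)$, $H(2d,q)$ denote the finite classical polar spaces of rank $d$ (hyperbolic, parabolic, elliptic quadric; symplectic; Hermitian) in projective spaces of the indicated projective dimension over $\mathbb{F}_q$. Points are the totally isotropic/singular subspaces of dimension 1, generators those of the maximal dimension $d$. A cross-intersecting EKR set of generators is a pair $(Y,Z)$ of sets of generators such that every $y\in Y$ and $z\in Z$ satisfy $\dim(y\cap z)\ge 1$. An EKR set is a set $Y$ of generators any two of which intersect in at least a point. *)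

theory Defs
  imports "HOL-Analysis.Analysis"
begin

section \<open>Forms on a coordinate space over a finite field\<close>

definition bilinear_form :: "('a::field ^ 'n \<Rightarrow> 'a ^ 'n \<Rightarrow> 'a) \<Rightarrow> bool" where
  "bilinear_form B \<longleftrightarrow>
     (\<forall>v. Vector_Spaces.linear (*s) (*) (\<lambda>u. B u v)) \<and>
     (\<forall>u. Vector_Spaces.linear (*s) (*) (\<lambda>v. B u v))"

definition nondegenerate_form :: "('a::field ^ 'n \<Rightarrow> 'a ^ 'n \<Rightarrow> 'a) \<Rightarrow> bool" where
  "nondegenerate_form B \<longleftrightarrow> (\<forall>u. (\<forall>v. B u v = 0) \<longrightarrow> u = 0)"

definition alternating_form :: "('a::field ^ 'n \<Rightarrow> 'a ^ 'n \<Rightarrow> 'a) \<Rightarrow> bool" where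
  "alternating_form B \<longleftrightarrow> bilinear_form B \<and> (\<forall>u. B u u = 0)"

text \<open>The field has order \<open>r\<^sup>2\<close>, and its involution is \<open>x \<mapsto> x ^ r\<close>.
  Semilinearity in the second argument follows from the two clauses given.\<close>

definition hermitian_form :: "nat \<Rightarrow> ('a::{field,finite} ^ 'n \<Rightarrow> 'a ^ 'n \<Rightarrow> 'a) \<Rightarrow> bool" where
  "hermitian_form r h \<longleftrightarrow>
     CARD('a) = r\<^sup>2 \<and>
     (\<forall>v. Vector_Spaces.linear (*s) (*) (\<lambda>u. h u v)) \<and>
     (\<forall>u v. h v u = h u v ^ r)"

definition polar_form :: "('a::field ^ 'n \<Rightarrow> 'a) \<Rightarrow> 'a ^ 'n \<Rightarrow> 'a ^ 'n \<Rightarrow> 'a" where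
  "polar_form Q u v = Q (u + v) - Q u - Q v"

definition quadratic_form :: "('a::field ^ 'n \<Rightarrow> 'a) \<Rightarrow> bool" where
  "quadratic_form Q \<longleftrightarrow>
     (\<forall>c u. Q (c *s u) = c\<^sup>2 * Q u) \<and> bilinear_form (polar_form Q)"

text \<open>Only singular vectors are excluded from the radical of the polar form: in
  characteristic 2 and odd dimension that radical is never zero.\<close>

definition nondegenerate_quadratic_form :: "('a::field ^ 'n \<Rightarrow> 'a) \<Rightarrow> bool" where
  "nondegenerate_quadratic_form Q \<longleftrightarrow>
     quadratic_form Q \<and> (\<forall>u. Q u = 0 \<and> (\<forall>v. polar_form Q u v = 0) \<longrightarrow> u = 0)"


section \<open>Finite classical polar spaces\<close>

text \<open>A polar space is represented by the set of all its totally isotropic (respectively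
  totally singular) subspaces, the zero subspace included.\<close>

definition isotropic_subspaces ::
    "('a::field ^ 'n \<Rightarrow> 'a ^ 'n \<Rightarrow> 'a) \<Rightarrow> ('a ^ 'n) set set" where
  "isotropic_subspaces B = {U. vec.subspace U \<and> (\<forall>u\<in>U. \<forall>v\<in>U. B u v = 0)}"

definition singular_subspaces :: "('a::field ^ 'n \<Rightarrow> 'a) \<Rightarrow> ('a ^ 'n) set set" where
  "singular_subspaces Q = {U. vec.subspace U \<and> (\<forall>u\<in>U. Q u = 0)}"

definition polar_rank :: "('a::{field,finite} ^ 'n) set set \<Rightarrow> nat" where
  "polar_rank P = Max (vec.dim ` P)"

definition points :: "('a::{field,finite} ^ 'n) set set \<Rightarrow> ('a ^ 'n) set set" where
  "points P = {U \<in> P. vec.dim U = 1}"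

definition generators :: "('a::{field,finite} ^ 'n) set set \<Rightarrow> ('a ^ 'n) set set" where
  "generators P = {U \<in> P. vec.dim U = polar_rank P}"

definition quadric :: "('a::{field,finite} ^ 'n) set set \<Rightarrow> bool" where
  "quadric P \<longleftrightarrow> (\<exists>Q. nondegenerate_quadratic_form Q \<and> P = singular_subspaces Q)"

text \<open>In the following, \<open>d\<close> is the rank, the field is that of order \<open>q = CARD('a)\<close>, and
  \<open>CARD('n)\<close> is one more than the dimension of the ambient projective space. In even
  vector space dimension the hyperbolic and elliptic quadrics differ exactly in their rank.\<close>

definition hyperbolic_quadric :: "nat \<Rightarrow> ('a::{field,finite} ^ 'n) set set \<Rightarrow> bool" where
  "hyperbolic_quadric d P \<longleftrightarrow> CARD('n) = 2 * d \<and> quadric P \<and> polar_rank P = d"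

definition parabolic_quadric :: "nat \<Rightarrow> ('a::{field,finite} ^ 'n) set set \<Rightarrow> bool" where
  "parabolic_quadric d P \<longleftrightarrow> CARD('n) = 2 * d + 1 \<and> quadric P \<and> polar_rank P = d"

definition elliptic_quadric :: "nat \<Rightarrow> ('a::{field,finite} ^ 'n) set set \<Rightarrow> bool" where
  "elliptic_quadric d P \<longleftrightarrow> CARD('n) = 2 * d + 2 \<and> quadric P \<and> polar_rank P = d"

definition symplectic_space :: "nat \<Rightarrow> ('a::{field,finite} ^ 'n) set set \<Rightarrow> bool" where
  "symplectic_space d P \<longleftrightarrow> CARD('n) = 2 * d \<and> polar_rank P = d \<and>
     (\<exists>B. alternating_form B \<and> nondegenerate_form B \<and> P = isotropic_subspaces B)"

definition even_hermitian_space :: "nat \<Rightarrow> ('a::{field,finite} ^ 'n) set set \<Rightarrow> bool" where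
  "even_hermitian_space d P \<longleftrightarrow> CARD('n) = 2 * d + 1 \<and> polar_rank P = d \<and>
     (\<exists>r h. hermitian_form r h \<and> nondegenerate_form h \<and> P = isotropic_subspaces h)"


section \<open>EKR sets of generators\<close>

definition EKR_set :: "('a::{field,finite} ^ 'n) set set \<Rightarrow> ('a ^ 'n) set set \<Rightarrow> bool" where
  "EKR_set P Y \<longleftrightarrow>
     Y \<subseteq> generators P \<and> (\<forall>y\<in>Y. \<forall>z\<in>Y. vec.dim (y \<inter> z) \<ge> 1)"

definition cross_intersecting_EKR_set ::
    "('a::{field,finite} ^ 'n) set set \<Rightarrow> ('a ^ 'n) set set \<Rightarrow> ('a ^ 'n) set set \<Rightarrow> bool" where
  "cross_intersecting_EKR_set P Y Z \<longleftrightarrow>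
     Y \<subseteq> generators P \<and> Z \<subseteq> generators P \<and> (\<forall>y\<in>Y. \<forall>z\<in>Z. vec.dim (y \<inter> z) \<ge> 1)"

end

theory Submission
  imports Defs "HOL-Computational_Algebra.Polynomial"
begin

text \<open>The proof is the eigenvalue method for independent sets, in its form for two sets. Let \<open>A\<close> be
  the adjacency matrix of the graph on the generators in which two generators are joined when
  they meet only in \<open>0\<close>; it is regular, say of valency \<open>k\<close>. A cross-intersecting pair satisfies
  \<open>ind Y \<bullet> A (ind Z) = 0\<close>. If \<open>\<mu>\<close> is such that all eigenvalues of \<open>A\<close> on the vectors
  orthogonal to the all-one vector lie in \<open>[- \<mu>, \<mu>]\<close>, this forces
  \<open>sqrt (card Y * card Z) \<le> b\<close> where \<open>k * b = \<mu> * (n - b)\<close>. If moreover \<open>\<mu>\<close> itself is not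
  such an eigenvalue, then equality forces \<open>ind Y = ind Z\<close>: the components of \<open>ind Y\<close> and
  \<open>ind Z\<close> orthogonal to the all-one vector agree in the eigenspace of \<open>- \<mu>\<close> and would be opposite
  in the eigenspace of \<open>\<mu>\<close>. This is \<open>cross_ratio_bound_equality\<close>. The claim about EKR sets follows
  at once from \<open>Y = Z\<close>.

  The spectrum of \<open>A\<close> is read off from a filtration. For a totally isotropic subspace \<open>U\<close>
  let the pencil of \<open>U\<close> be the set of all generators containing \<open>U\<close>. The indicator vectors of the
  pencils of subspaces of dimension at most \<open>j\<close> span spaces that increase with \<open>j\<close> from the
  constants to everything. A generator \<open>x\<close> is disjoint from either none or a constant number of
  the generators through \<open>U\<close>, according as \<open>x\<close> does or does not meet \<open>U\<close>
  (\<open>card_Gen_above_opposite\<close>). Moebius inversion in the subspace lattice of \<open>U\<close> expresses the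
  indicator of the generators that miss \<open>U\<close> as \<open>(-1) ^ j * q ^ (j choose 2)\<close> times the pencil of
  \<open>U\<close> plus pencils of smaller subspaces (\<open>meet_pencil_mod_lower_span\<close>). So \<open>A\<close> is triangular for
  this filtration, and being symmetric it has exactly the diagonal values as its eigenvalues
  (\<open>disjointness_eigval\<close>, \<open>filtered_selfadjoint_bounds\<close>).

  All counting rests on the single number \<open>\<gamma> + 1\<close> of generators through a totally isotropic
  subspace of dimension \<open>d - 1\<close>. It is \<open>1 + 1\<close> for \<open>Q\<^sup>+(2d-1,q)\<close>, \<open>q + 1\<close> for \<open>Q(2d,q)\<close> and
  \<open>W(2d-1,q)\<close>, \<open>q * sqrt q + 1\<close> for \<open>H(2d,q)\<close>, and \<open>q\<^sup>2 + 1\<close> for \<open>Q\<^sup>-(2d+1,q)\<close>. The three kinds of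
  forms are treated uniformly by the locale \<open>polar_space_form\<close>, in which \<open>\<gamma>\<close> is determined by the
  number of isotropic vectors on a line through an isotropic point
  (\<open>card_Gen_above_corank1\<close>).\<close>

section \<open>Subspaces of a finite vector space\<close>

lemma card_span_independent:
  fixes S :: "('a::{field,finite} ^ 'n) set"
  assumes "finite S" "vec.independent S"
  shows "card (vec.span S) = CARD('a) ^ card S"
  using assms
proof (induction S rule: finite_induct)
  case (insert x S)
  have x: "x \<notin> vec.span S" and S: "vec.independent S"
    using insert.prems insert.hyps by (auto simp: vec.independent_insert)
  let ?f = "\<lambda>(k::'a, y). k *s x + y"
  have "bij_betw ?f (UNIV \<times> vec.span S) (vec.span (insert x S))"
  proof (intro bij_betwI')
    fix a b :: "'a \<times> ('a ^ 'n)" assume "a \<in> UNIV \<times> vec.span S" "b \<in> UNIV \<times> vec.span S"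
    moreover obtain k y l z where ab: "a = (k, y)" "b = (l, z)" by (cases a, cases b)
    ultimately have yz: "y \<in> vec.span S" "z \<in> vec.span S" by auto
    have "k = l \<and> y = z" if eq: "k *s x + y = l *s x + z"
    proof -
      have *: "(k - l) *s x = z - y"
        using eq by (simp only: vec.scale_left_diff_distrib) (metis add_diff_cancel_left' add_diff_eq diff_add_eq eq_diff_eq)
      have "k = l"
      proof (rule ccontr)
        assume "k \<noteq> l"
        have "(k - l) *s x \<in> vec.span S" unfolding * using yz by (rule vec.span_diff[rotated])
        hence "inverse (k - l) *s ((k - l) *s x) \<in> vec.span S" by (rule vec.span_scale)
        hence "x \<in> vec.span S" using \<open>k \<noteq> l\<close> by (simp only: vec.scale_scale) simp
        thus False using x by simp
      qed
      thus ?thesis using * by simp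
    qed
    thus "(?f a = ?f b) = (a = b)" using ab by auto
  next
    fix a :: "'a \<times> ('a ^ 'n)" assume "a \<in> UNIV \<times> vec.span S"
    thus "?f a \<in> vec.span (insert x S)"
      by (auto intro!: vec.span_add vec.span_scale intro: vec.span_base
               dest: subsetD[OF vec.span_mono[OF subset_insertI]])
  next
    fix v assume "v \<in> vec.span (insert x S)"
    then obtain k where "v - k *s x \<in> vec.span S" by (auto simp: vec.span_insert)
    thus "\<exists>a\<in>UNIV \<times> vec.span S. v = ?f a"
      by (intro bexI[of _ "(k, v - k *s x)"]) auto
  qed
  hence "card (vec.span (insert x S)) = card ((UNIV::'a set) \<times> vec.span S)"
    by (simp add: bij_betw_same_card)
  also have "\<dots> = CARD('a) ^ card (insert x S)"
    using insert S by (simp add: card_cartesian_product)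
  finally show ?case .
qed simp

lemma card_subspace:
  fixes U :: "('a::{field,finite} ^ 'n) set"
  assumes "vec.subspace U"
  shows "card U = CARD('a) ^ vec.dim U"
proof -
  obtain S where S: "S \<subseteq> U" "vec.independent S" "U \<subseteq> vec.span S" "card S = vec.dim U"
    by (rule vec.basis_exists)
  have "vec.span S = U" using vec.span_minimal[OF S(1) assms] S(3) by auto
  thus ?thesis using card_span_independent[of S] S(2,4) by (simp add: vec.finiteI_independent)
qed

lemma two_le_card_field: "2 \<le> CARD('a::{field,finite})"
proof -
  have "card {0::'a, 1} \<le> CARD('a)" by (rule card_mono) auto
  thus ?thesis by simp
qed

lemma dim_strict_mono:
  fixes U W :: "('a::field ^ 'n) set"
  assumes "vec.subspace U" "vec.subspace W" "U \<subset> W"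
  shows "vec.dim U < vec.dim W"
  using assms vec.dim_psubset[of U W] by (metis vec.span_eq_iff)

abbreviation subspace_sum :: "('a::field ^ 'n) set \<Rightarrow> ('a ^ 'n) set \<Rightarrow> ('a ^ 'n) set" where
  "subspace_sum U W \<equiv> {x + y |x y. x \<in> U \<and> y \<in> W}"

lemma subspace_sum_upper:
  fixes U W :: "('a::field ^ 'n) set"
  assumes "vec.subspace U" "vec.subspace W"
  shows "U \<subseteq> subspace_sum U W" "W \<subseteq> subspace_sum U W"
proof -
  show "U \<subseteq> subspace_sum U W"
    using vec.subspace_0[OF assms(2)] by force
  show "W \<subseteq> subspace_sum U W"
    using vec.subspace_0[OF assms(1)] by force
qed

lemma subspace_sum_least:
  fixes X :: "('a::field ^ 'n) set"
  assumes "vec.subspace X" "U \<subseteq> X" "W \<subseteq> X"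
  shows "subspace_sum U W \<subseteq> X"
  using assms by (auto intro!: vec.subspace_add)

text \<open>Extend a basis of \<open>S\<close> to one of \<open>U\<close> and drop one of the new vectors.\<close>

lemma obtain_hyperplane_above:
  fixes S U :: "('a::field ^ 'n) set"
  assumes "vec.subspace S" "vec.subspace U" "S \<subset> U"
  obtains G where "vec.subspace G" "S \<subseteq> G" "G \<subseteq> U" "vec.dim U = vec.dim G + 1"
proof -
  obtain C where C: "C \<subseteq> S" "vec.independent C" "S \<subseteq> vec.span C" "card C = vec.dim S"
    by (rule vec.basis_exists)
  have "C \<subseteq> U" using C assms by auto
  then obtain D where D: "C \<subseteq> D" "D \<subseteq> U" "vec.independent D" "U \<subseteq> vec.span D"
    by (rule vec.maximal_independent_subset_extend[OF _ C(2)])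
  have span: "vec.span C = S" "vec.span D = U"
    using subset_antisym[OF vec.span_minimal[OF C(1) assms(1)] C(3)]
      subset_antisym[OF vec.span_minimal[OF D(2) assms(2)] D(4)] by simp_all
  have "D \<noteq> C" using span assms(3) by blast
  then obtain a where a: "a \<in> D" "a \<notin> C" using D(1) by blast
  let ?G = "vec.span (D - {a})"
  have ind: "vec.independent (D - {a})" using D(3) by (rule vec.independent_mono) auto
  have fin: "finite D" using D(3) by (rule vec.finiteI_independent)
  have "vec.dim U = card D" using vec.dim_span_eq_card_independent[OF D(3)] span(2) by simp
  moreover have "vec.dim ?G = card (D - {a})" using ind by (rule vec.dim_span_eq_card_independent)
  moreover have "card D = card (D - {a}) + 1" using a(1) fin card_Suc_Diff1[of D a] by simp
  moreover have "S \<subseteq> ?G"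
  proof -
    have "C \<subseteq> D - {a}" using a D(1) by blast
    thus ?thesis using vec.span_mono[of C "D - {a}"] span(1) by simp
  qed
  moreover have "?G \<subseteq> U" using vec.span_mono[of "D - {a}" D] span(2) by simp
  ultimately show thesis by (intro that[of ?G]) simp_all
qed

lemma Int_hyperplane_dim:
  fixes T G Z :: "('a::field ^ 'n) set"
  assumes "vec.subspace T" "vec.subspace G" "T \<subseteq> Z" "G \<subseteq> Z" "vec.subspace Z"
    and "vec.dim Z = vec.dim G + 1" "\<not> T \<subseteq> G"
  shows "vec.dim T = vec.dim (T \<inter> G) + 1"
proof -
  have "vec.dim (subspace_sum T G) \<le> vec.dim Z"
    using assms by (intro vec.dim_subset subspace_sum_least) auto
  hence "vec.dim T \<le> vec.dim (T \<inter> G) + 1"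
    using vec.dim_sums_Int[OF assms(1,2)] assms(6) by linarith
  moreover have "vec.dim (T \<inter> G) < vec.dim T"
    using assms by (intro dim_strict_mono vec.subspace_inter) auto
  ultimately show ?thesis by simp
qed

text \<open>For a hyperplane \<open>G\<close> of \<open>Z\<close> above \<open>S\<close> these are, in the quotient of \<open>Z\<close> by \<open>S\<close>, the points outside
  the hyperplane. Both recursions below, for opposite generators and for Moebius
  inversion, sum over this set.\<close>

definition covers_off :: "('a::field ^ 'n) set \<Rightarrow> ('a ^ 'n) set \<Rightarrow> ('a ^ 'n) set \<Rightarrow> ('a ^ 'n) set set" where
  "covers_off S G Z =
     {T. vec.subspace T \<and> S \<subseteq> T \<and> T \<subseteq> Z \<and> vec.dim T = vec.dim S + 1 \<and> \<not> T \<subseteq> G}"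

lemma covers_off_Int:
  fixes S G Z :: "('a::field ^ 'n) set"
  assumes "vec.subspace S" "vec.subspace G" "S \<subseteq> G" and T: "T \<in> covers_off S G Z"
  shows "T \<inter> G = S"
proof -
  have "vec.dim (T \<inter> G) < vec.dim T"
    using assms by (intro dim_strict_mono vec.subspace_inter) (auto simp: covers_off_def)
  thus ?thesis
    using assms by (intro vec.subspace_dim_equal[symmetric] vec.subspace_inter)
      (auto simp: covers_off_def)
qed

text \<open>The sets \<open>T - G\<close>, with \<open>T\<close> a cover of \<open>S\<close> off \<open>G\<close>, partition \<open>Z - G\<close> into parts of equal size,
  since such a \<open>T\<close> meets \<open>G\<close> exactly in \<open>S\<close>.\<close>

lemma card_covers_off:
  fixes S G Z :: "('a::{field,finite} ^ 'n) set"
  assumes S: "vec.subspace S" and G: "vec.subspace G" and Z: "vec.subspace Z"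
    and SG: "S \<subseteq> G" and GZ: "G \<subseteq> Z" and dim: "vec.dim Z = vec.dim G + 1"
  shows "card (covers_off S G Z) = CARD('a) ^ (vec.dim G - vec.dim S)"
proof -
  let ?q = "CARD('a)"
  let ?C = "covers_off S G Z"
  have sub: "vec.subspace T" "S \<subseteq> T" "T \<subseteq> Z" "vec.dim T = vec.dim S + 1" if "T \<in> ?C" for T
    using that by (auto simp: covers_off_def)
  have TG: "T - G = T - S" if "T \<in> ?C" for T
    using covers_off_Int[OF S G SG that] by blast
  have card_T: "card (T - G) = ?q ^ vec.dim S * (?q - 1)" if "T \<in> ?C" for T
    using sub[OF that] S by (simp add: TG[OF that] card_Diff_subset card_subspace algebra_simps)
  have disj: "(T - G) \<inter> (T' - G) = {}" if TT: "T \<in> ?C" "T' \<in> ?C" "T \<noteq> T'" for T T'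
  proof -
    have "\<not> T \<subseteq> T'"
      using TT sub vec.subspace_dim_equal[of T T'] by (metis order_refl)
    hence "vec.dim (T \<inter> T') < vec.dim T"
      using TT sub by (intro dim_strict_mono vec.subspace_inter) auto
    hence "vec.dim (T \<inter> T') \<le> vec.dim S" using sub(4)[OF TT(1)] by simp
    hence "S = T \<inter> T'"
      using TT sub S by (intro vec.subspace_dim_equal vec.subspace_inter) auto
    thus ?thesis using SG by blast
  qed
  have "Z - G = (\<Union>T\<in>?C. T - G)"
  proof
    show "Z - G \<subseteq> (\<Union>T\<in>?C. T - G)"
    proof
      fix v assume v: "v \<in> Z - G"
      let ?T = "vec.span (insert v S)"
      have vS: "v \<notin> vec.span S" using v S SG by (auto simp: vec.span_eq_iff[THEN iffD2])
      have "?T \<subseteq> Z" using v Z SG GZ by (intro vec.span_minimal) auto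
      moreover have "S \<subseteq> ?T" using vec.span_superset[of "insert v S"] by blast
      moreover have "vec.dim ?T = vec.dim S + 1" using vS by (simp add: vec.dim_insert)
      moreover have "v \<in> ?T" by (simp add: vec.span_base)
      ultimately have "?T \<in> ?C" using v by (auto simp: covers_off_def)
      thus "v \<in> (\<Union>T\<in>?C. T - G)" using v by (auto intro!: bexI[of _ ?T] vec.span_base)
    qed
    show "(\<Union>T\<in>?C. T - G) \<subseteq> Z - G" using sub(3) by blast
  qed
  hence "card (Z - G) = (\<Sum>T\<in>?C. card (T - G))"
    using card_UN_disjoint[of ?C "\<lambda>T. T - G"] disj by simp
  hence "?q ^ vec.dim G * (?q - 1) = card ?C * (?q ^ vec.dim S * (?q - 1))"
    using G Z GZ dim by (simp add: card_T card_Diff_subset card_subspace algebra_simps)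
  moreover have "?q ^ vec.dim G = ?q ^ (vec.dim G - vec.dim S) * ?q ^ vec.dim S"
    using vec.dim_subset[OF SG] by (simp flip: power_add)
  ultimately show ?thesis using two_le_card_field[where 'a='a] by simp
qed

section \<open>Polar spaces of reflexive forms\<close>

lemma card_kernel_functional:
  fixes f :: "'a::{field,finite} ^ 'n \<Rightarrow> 'a"
  assumes add: "\<And>u v. f (u + v) = f u + f v" and scale: "\<And>k u. f (k *s u) = k * f u"
    and X: "vec.subspace X" and x0: "x0 \<in> X" "f x0 \<noteq> 0"
  shows "card X = CARD('a) * card {x \<in> X. f x = 0}"
proof -
  let ?K = "{x \<in> X. f x = 0}"
  have diff: "f (u - v) = f u - f v" for u v
    using add[of "u - v" v] by simp
  have "bij_betw (\<lambda>(t, k). t *s x0 + k) (UNIV \<times> ?K) X"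
    by (rule bij_betw_byWitness[where f' = "\<lambda>x. (f x / f x0, x - (f x / f x0) *s x0)"])
       (use X x0 in \<open>auto simp: add scale diff intro!: vec.subspace_add vec.subspace_scale vec.subspace_diff\<close>)
  hence "card X = card ((UNIV :: 'a set) \<times> ?K)" by (simp add: bij_betw_same_card)
  thus ?thesis by (simp add: card_cartesian_product)
qed

text \<open>The common ground of quadratic, alternating and Hermitian forms. \<open>B\<close> is the (polar) form and \<open>I\<close>
  the set of singular or isotropic vectors; \<open>B\<close> is assumed linear in the first argument only,
  because a Hermitian form is merely semilinear in the second, and nondegenerate on \<open>I\<close>
  only, because the polar form of a parabolic quadric in characteristic 2 has a radical.
  The parameter \<open>c\<close> tells the types of forms apart: it is the number of isotropic vectors in a
  coset \<open>v + \<langle>u\<rangle>\<close> with \<open>u\<close> isotropic and \<open>v\<close> not perpendicular to \<open>u\<close>. The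
  number \<open>\<gamma> + 1\<close> will turn out to count the generators through a totally isotropic subspace of
  dimension \<open>d - 1\<close>.\<close>

locale polar_space_form =
  fixes B :: "'a::{field,finite} ^ 'n \<Rightarrow> 'a ^ 'n \<Rightarrow> 'a"
    and I :: "('a ^ 'n) set" and P :: "('a ^ 'n) set set" and c m \<gamma> :: nat
  assumes B_linear: "\<And>v. Vector_Spaces.linear (*s) (*) (\<lambda>u. B u v)"
    and B_reflexive: "\<And>u v. B u v = 0 \<Longrightarrow> B v u = 0"
    and zero_in_I: "0 \<in> I"
    and scale_in_I: "\<And>k u. u \<in> I \<Longrightarrow> k *s u \<in> I"
    and add_in_I: "\<And>u v. u \<in> I \<Longrightarrow> v \<in> I \<Longrightarrow> B u v = 0 \<Longrightarrow> u + v \<in> I"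
    and I_isotropic: "\<And>u. u \<in> I \<Longrightarrow> B u u = 0"
    and I_nondegenerate: "\<And>u. u \<in> I \<Longrightarrow> u \<noteq> 0 \<Longrightarrow> \<exists>v. B v u \<noteq> 0"
    and card_line: "\<And>u v. u \<in> I \<Longrightarrow> B v u \<noteq> 0 \<Longrightarrow> card {t. v + t *s u \<in> I} = c"
    and P_eq: "P = {U. vec.subspace U \<and> U \<subseteq> I \<and> (\<forall>u\<in>U. \<forall>v\<in>U. B u v = 0)}"
    and ambient_dim: "CARD('n) = 2 * polar_rank P + m"
    and order_eq: "\<gamma> = c * CARD('a) ^ m"
begin

abbreviation "d \<equiv> polar_rank P"
abbreviation "Gen \<equiv> generators P"

definition perp :: "('a ^ 'n) set \<Rightarrow> ('a ^ 'n) set" where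
  "perp X = {v. \<forall>x\<in>X. B v x = 0}"

lemma B_add: "B (u + v) w = B u w + B v w"
  and B_scale: "B (k *s u) w = k * B u w"
  using B_linear[of w] by (simp_all add: Vector_Spaces.linear_iff)

lemma B_commute_0: "B u v = 0 \<longleftrightarrow> B v u = 0"
  using B_reflexive by blast

lemma B_zero [simp]: "B 0 w = 0"
  using B_scale[of 0 0 w] by simp

lemma B_zero_right [simp]: "B w 0 = 0"
  using B_reflexive[OF B_zero] .

lemma subspace_perp: "vec.subspace (perp X)"
  by (rule vec.subspaceI) (auto simp: perp_def B_add B_scale)

lemma perp_antimono: "X \<subseteq> Y \<Longrightarrow> perp Y \<subseteq> perp X"
  by (auto simp: perp_def)

lemma P_D:
  assumes "U \<in> P"
  shows "vec.subspace U" "U \<subseteq> I" "U \<subseteq> perp U"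
  using assms by (auto simp: P_eq perp_def)

lemma P_subspace: "U \<in> P \<Longrightarrow> vec.subspace W \<Longrightarrow> W \<subseteq> U \<Longrightarrow> W \<in> P"
  unfolding P_eq by blast

lemma zero_in_P: "{0} \<in> P"
  using zero_in_I by (auto simp: P_eq)

lemma sum_in_P:
  assumes U: "U \<in> P" and W: "W \<in> P" and perp: "W \<subseteq> perp U"
  shows "subspace_sum U W \<in> P"
proof -
  have WU: "B w u = 0" "B u w = 0" if "u \<in> U" "w \<in> W" for u w
    using that perp B_commute_0 by (auto simp: perp_def)
  have UU: "B u u' = 0" if "u \<in> U" "u' \<in> U" for u u' using that U by (auto simp: P_eq)
  have WW: "B u u' = 0" if "u \<in> W" "u' \<in> W" for u u' using that W by (auto simp: P_eq)
  have "B (u + w) (u' + w') = 0" if "u \<in> U" "w \<in> W" "u' \<in> U" "w' \<in> W" for u w u' w'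
  proof -
    have "B (u' + w') u = 0" "B (u' + w') w = 0" using that by (auto simp: B_add WU UU WW)
    hence "B u (u' + w') = 0" "B w (u' + w') = 0" by (simp_all add: B_reflexive)
    thus ?thesis by (simp only: B_add add_0)
  qed
  moreover have "subspace_sum U W \<subseteq> I"
    using P_D[OF U] P_D[OF W] WU by (auto intro!: add_in_I)
  ultimately show ?thesis
    using P_D(1)[OF U] P_D(1)[OF W] by (auto simp: P_eq intro: vec.subspace_sums)
qed

lemma span_singleton_in_P: "v \<in> I \<Longrightarrow> vec.span {v} \<in> P"
proof -
  assume v: "v \<in> I"
  have "B (k *s v) (l *s v) = 0" for k l
    using B_reflexive[of "l *s v" v] I_isotropic[OF v] by (simp add: B_scale)
  thus ?thesis using v vec.subspace_span[of "{v}"] by (auto simp: P_eq vec.span_singleton scale_in_I)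
qed

lemma dim_le_rank: "U \<in> P \<Longrightarrow> vec.dim U \<le> d"
  unfolding polar_rank_def by (intro Max_ge) auto

lemma Gen_D:
  assumes "x \<in> Gen"
  shows "x \<in> P" "vec.dim x = d" "vec.subspace x"
  using assms P_D(1) by (auto simp: generators_def)

lemma Gen_I: "x \<in> P \<Longrightarrow> vec.dim x = d \<Longrightarrow> x \<in> Gen"
  by (simp add: generators_def)

lemma Gen_nonempty: "Gen \<noteq> {}"
proof -
  have "d \<in> vec.dim ` P"
    unfolding polar_rank_def using zero_in_P by (intro Max_in) auto
  thus ?thesis by (auto simp: generators_def)
qed

lemma Gen_eqI: "x \<in> P \<Longrightarrow> y \<in> P \<Longrightarrow> x \<in> Gen \<Longrightarrow> x \<subseteq> y \<Longrightarrow> x = y"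
  using Gen_D(2)[of x] dim_le_rank[of y] P_D(1) by (intro vec.subspace_dim_equal) auto

text \<open>A generator together with \<open>v\<close> would otherwise span a larger totally isotropic subspace.\<close>

lemma Gen_maximal:
  assumes x: "x \<in> Gen" and v: "v \<in> I" "v \<in> perp x"
  shows "v \<in> x"
proof -
  have xP: "x \<in> P" using Gen_D x by blast
  have "vec.span {v} \<subseteq> perp x"
    using v(2) subspace_perp by (intro vec.span_minimal) auto
  hence "subspace_sum x (vec.span {v}) \<in> P"
    by (intro sum_in_P xP span_singleton_in_P v(1))
  hence "x = subspace_sum x (vec.span {v})"
    using x xP subspace_sum_upper(1)[of x "vec.span {v}"] P_D(1) by (intro Gen_eqI) auto
  moreover have "v \<in> vec.span {v}" by (simp add: vec.span_base)
  ultimately show ?thesis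
    using subspace_sum_upper(2)[of x "vec.span {v}"] P_D(1)[OF xP] by auto
qed

lemma Int_perp_Gen:
  assumes "x \<in> Gen" "U \<in> P"
  shows "U \<inter> perp x = U \<inter> x"
  using Gen_maximal[OF assms(1)] P_D(2)[OF assms(2)] P_D(3)[OF Gen_D(1)[OF assms(1)]] by blast

text \<open>Counting the perpendicular pairs in \<open>U \<times> X\<close> from both sides: \<open>U \<inter> perp {x}\<close> is all of \<open>U\<close> or has
  \<open>1 / q\<close> of its elements, and likewise with \<open>U\<close> and \<open>X\<close> exchanged. With
  \<open>X = UNIV\<close> it gives the dimension of \<open>perp U\<close>, and with \<open>X\<close> a generator that of \<open>X \<inter> perp U\<close>.\<close>

lemma dim_perp_swap:
  assumes X: "vec.subspace X" and U: "vec.subspace U"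
  shows "vec.dim X + vec.dim (U \<inter> perp X) = vec.dim U + vec.dim (X \<inter> perp U)"
proof -
  have aux: "CARD('a) * (\<Sum>x\<in>X. card {u \<in> U. B u x = 0}) + card (X \<inter> perp U) * card U
      = CARD('a) * (card (X \<inter> perp U) * card U) + card X * card U"
    if U: "vec.subspace U" for X U :: "('a ^ 'n) set"
  proof -
    have 1: "CARD('a) * card {u \<in> U. B u x = 0} = (if x \<in> perp U then CARD('a) * card U else card U)" for x
    proof (cases "x \<in> perp U")
      case True
      hence "{u \<in> U. B u x = 0} = U" using B_commute_0 by (auto simp: perp_def)
      thus ?thesis using True by simp
    next
      case False
      then obtain u where "u \<in> U" "B u x \<noteq> 0" using B_commute_0 by (auto simp: perp_def)
      thus ?thesis
        using card_kernel_functional[of "\<lambda>u. B u x" U u] U False by (simp add: B_add B_scale)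
    qed
    have "CARD('a) * (\<Sum>x\<in>X. card {u \<in> U. B u x = 0})
        = (\<Sum>x\<in>X. if x \<in> perp U then CARD('a) * card U else card U)"
      by (simp add: sum_distrib_left 1)
    also have "\<dots> = card (X \<inter> perp U) * (CARD('a) * card U) + card (X - perp U) * card U"
      by (simp add: sum.If_cases Int_def Diff_eq)
    finally have "CARD('a) * (\<Sum>x\<in>X. card {u \<in> U. B u x = 0}) + card (X \<inter> perp U) * card U =
       card (X \<inter> perp U) * (CARD('a) * card U) + (card (X \<inter> perp U) + card (X - perp U)) * card U"
      by (simp add: algebra_simps)
    also have "card (X \<inter> perp U) + card (X - perp U) = card X"
      by (metis card_Int_Diff finite)
    finally show ?thesis by (simp add: algebra_simps)
  qed
  have "(\<Sum>x\<in>X. card {u \<in> U. B u x = 0}) = (\<Sum>x\<in>X. \<Sum>u\<in>U. if B u x = 0 then 1 else 0)"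
    by (simp add: sum.If_cases Int_def)
  also have "\<dots> = (\<Sum>u\<in>U. \<Sum>x\<in>X. if B x u = 0 then 1 else 0)"
    by (subst sum.swap) (simp add: B_commute_0)
  also have "\<dots> = (\<Sum>u\<in>U. card {x \<in> X. B x u = 0})"
    by (simp add: sum.If_cases Int_def)
  finally have swap: "(\<Sum>x\<in>X. card {u \<in> U. B u x = 0}) = (\<Sum>u\<in>U. card {x \<in> X. B x u = 0})" .
  let ?a = "card (X \<inter> perp U) * card U" and ?b = "card (U \<inter> perp X) * card X"
  obtain r where r: "CARD('a) = Suc (Suc r)" using two_le_card_field[where 'a='a]
    by (metis One_nat_def Suc_1 Suc_le_D Suc_le_mono)
  have "CARD('a) * ?a + ?b = CARD('a) * ?b + ?a"
    using aux[OF U, of X] aux[OF X, of U] swap by (simp add: mult.commute[of "card X"])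
  hence "Suc r * ?a = Suc r * ?b" unfolding r by simp
  hence "?a = ?b" by (simp only: mult_cancel1) simp
  hence "CARD('a) ^ (vec.dim (X \<inter> perp U) + vec.dim U) = CARD('a) ^ (vec.dim (U \<inter> perp X) + vec.dim X)"
    using X U subspace_perp by (simp add: card_subspace vec.subspace_inter power_add)
  thus ?thesis using power_inject_exp[of "CARD('a)"] two_le_card_field[where 'a='a] by simp
qed

text \<open>The projection of a generator \<open>x\<close> to the residue of \<open>U\<close>: the generator through \<open>U\<close> that is closest
  to \<open>x\<close>.\<close>

definition proj :: "('a ^ 'n) set \<Rightarrow> ('a ^ 'n) set \<Rightarrow> ('a ^ 'n) set" where
  "proj U x = subspace_sum U (x \<inter> perp U)"

lemma dim_Int_perp_Gen:
  assumes "U \<in> P" "x \<in> Gen"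
  shows "vec.dim U + vec.dim (x \<inter> perp U) = d + vec.dim (U \<inter> x)"
  using dim_perp_swap[of x U] P_D(1)[OF assms(1)] Gen_D[OF assms(2)] Int_perp_Gen[OF assms(2,1)]
  by simp

lemma proj_upper:
  assumes "U \<in> P" "x \<in> Gen"
  shows "U \<subseteq> proj U x" "x \<inter> perp U \<subseteq> proj U x"
  unfolding proj_def using assms P_D(1) Gen_D(3) subspace_perp
  by (intro subspace_sum_upper vec.subspace_inter; simp)+

lemma proj_least: "vec.subspace X \<Longrightarrow> U \<subseteq> X \<Longrightarrow> x \<inter> perp U \<subseteq> X \<Longrightarrow> proj U x \<subseteq> X"
  unfolding proj_def by (rule subspace_sum_least)

lemma proj_in_Gen:
  assumes U: "U \<in> P" and x: "x \<in> Gen"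
  shows "proj U x \<in> Gen"
proof (rule Gen_I)
  have sub: "vec.subspace (x \<inter> perp U)"
    using Gen_D(3)[OF x] subspace_perp by (rule vec.subspace_inter)
  have "x \<inter> perp U \<in> P" using Gen_D(1)[OF x] sub by (rule P_subspace) auto
  thus "proj U x \<in> P" unfolding proj_def by (intro sum_in_P U) auto
  have "vec.dim (proj U x) + vec.dim (U \<inter> (x \<inter> perp U)) = vec.dim U + vec.dim (x \<inter> perp U)"
    unfolding proj_def using P_D(1)[OF U] sub by (rule vec.dim_sums_Int)
  moreover have "U \<inter> (x \<inter> perp U) = U \<inter> x" using P_D(3)[OF U] by blast
  ultimately show "vec.dim (proj U x) = d" using dim_Int_perp_Gen[OF U x] by simp
qed

lemma Gen_above:
  assumes "U \<in> P" obtains x where "x \<in> Gen" "U \<subseteq> x"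
  using Gen_nonempty proj_in_Gen[OF assms] proj_upper(1)[OF assms] by blast

lemma dim_perp_P:
  assumes U: "U \<in> P"
  shows "vec.dim U + vec.dim (perp U) = CARD('n)"
proof -
  have "U \<inter> perp UNIV = {0}"
  proof -
    have "u = 0" if "u \<in> U" "u \<in> perp UNIV" for u
      using that I_nondegenerate[of u] P_D(2)[OF U] B_commute_0[of u] by (auto simp: perp_def)
    moreover have "0 \<in> U \<inter> perp UNIV"
      using P_D(1)[OF U] subspace_perp by (simp add: vec.subspace_0)
    ultimately show ?thesis by blast
  qed
  thus ?thesis
    using dim_perp_swap[of UNIV U] P_D(1)[OF U] vec_dim_card[where 'a = 'a and 'n = 'n]
    by (simp del: vec.dim_UNIV)
qed

text \<open>Count the pairs of an element of \<open>W\<close> and an isotropic vector of \<open>W\<close> in the same coset of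
  \<open>\<langle>u\<rangle>\<close>: every coset in \<open>W\<close> contains \<open>c\<close> isotropic vectors among its \<open>q\<close> elements.\<close>

lemma card_isotropic_translates:
  assumes u: "u \<in> I" and inv: "\<And>v t. v \<in> W \<Longrightarrow> v + t *s u \<in> W"
    and nz: "\<And>v. v \<in> W \<Longrightarrow> B v u \<noteq> 0"
  shows "CARD('a) * card (W \<inter> I) = c * card W"
proof -
  have "c * card W = (\<Sum>v\<in>W. card {t. v + t *s u \<in> I})"
    using card_line[OF u nz] by simp
  also have "\<dots> = card (SIGMA v:W. {t. v + t *s u \<in> I})" by simp
  also have "\<dots> = card ((W \<inter> I) \<times> (UNIV :: 'a set))"
    by (rule bij_betw_same_card[of "\<lambda>(v, t). (v + t *s u, t)"],
        rule bij_betw_byWitness[where f' = "\<lambda>(w, t). (w + (-t) *s u, t)"])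
       (use inv[where t = "- t" for t] in \<open>auto simp: inv\<close>)
  also have "\<dots> = CARD('a) * card (W \<inter> I)" by (simp add: card_cartesian_product)
  finally show ?thesis ..
qed

text \<open>Let \<open>x\<close> be spanned by \<open>H\<close> and \<open>u\<close>. The isotropic vectors of \<open>perp H\<close> outside \<open>x\<close> are exactly
  those not perpendicular to \<open>u\<close>, as \<open>x\<close> is a maximal totally isotropic subspace. They are counted by
  translation along \<open>u\<close>, and they are partitioned by the remaining generators through \<open>H\<close>.\<close>

lemma card_Gen_above_corank1:
  assumes H: "H \<in> P" and dimH: "vec.dim H + 1 = d" and x: "x \<in> Gen" "H \<subseteq> x"
  shows "card {g \<in> Gen. H \<subseteq> g \<and> g \<noteq> x} = \<gamma>"
proof -
  let ?S = "{g \<in> Gen. H \<subseteq> g \<and> g \<noteq> x}"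
  have subH: "vec.subspace H" and subx: "vec.subspace x" using P_D(1) H Gen_D(3) x by auto
  have "H \<noteq> x" using dimH Gen_D(2)[OF x(1)] by auto
  then obtain u where u: "u \<in> x" "u \<notin> H" using x(2) by blast
  have uI: "u \<in> I" using u Gen_D(1)[OF x(1)] P_D(2) by blast
  have u_perp_H: "u \<in> perp H"
    using u x(2) P_D(3)[OF Gen_D(1)[OF x(1)]] perp_antimono by blast
  \<comment> \<open>\<open>x\<close> is spanned by \<open>H\<close> and \<open>u\<close>\<close>
  have perp_x: "perp H \<inter> {v. B v u = 0} = perp x"
  proof -
    let ?X = "vec.span (insert u H)"
    have "?X \<subseteq> x" using u(1) x(2) subx by (intro vec.span_minimal) auto
    moreover have "vec.dim ?X = d" using u(2) subH dimH by (simp add: vec.dim_insert vec.span_eq_iff[THEN iffD2])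
    ultimately have X: "?X = x" using Gen_D(2)[OF x(1)] subx
      by (intro vec.subspace_dim_equal) auto
    have "v \<in> perp x" if "v \<in> perp H" "B v u = 0" for v
    proof -
      have "insert u H \<subseteq> perp {v}" using that B_commute_0 by (auto simp: perp_def)
      hence "x \<subseteq> perp {v}" using vec.span_minimal[OF _ subspace_perp] X by blast
      thus ?thesis using B_commute_0 by (auto simp: perp_def)
    qed
    moreover have "perp x \<subseteq> perp H \<inter> {v. B v u = 0}" using u(1) x(2) by (auto simp: perp_def)
    ultimately show ?thesis by blast
  qed
  define W where "W = perp H - perp x"
  have W: "v \<in> W \<longleftrightarrow> v \<in> perp H \<and> B v u \<noteq> 0" for v
    using perp_x by (auto simp: W_def)
  have "CARD('a) * card (W \<inter> I) = c * card W"
  proof (rule card_isotropic_translates[OF uI])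
    show "v + t *s u \<in> W" if "v \<in> W" for v t
      using that u_perp_H I_isotropic[OF uI]
      by (auto simp: W B_add B_scale intro!: vec.subspace_add[OF subspace_perp] vec.subspace_scale[OF subspace_perp])
  qed (simp add: W)
  moreover have "card W = CARD('a) ^ (d + m) * (CARD('a) - 1)"
  proof -
    have "vec.dim (perp x) = d + m" using dim_perp_P[OF Gen_D(1)[OF x(1)]] Gen_D(2)[OF x(1)] ambient_dim by simp
    moreover have "vec.dim (perp H) = Suc (d + m)" using dim_perp_P[OF H] dimH ambient_dim by simp
    ultimately show ?thesis
      unfolding W_def using perp_antimono[OF x(2)] subspace_perp
      by (simp add: card_Diff_subset card_subspace algebra_simps)
  qed
  moreover have "card (W \<inter> I) = card ?S * (CARD('a) ^ vec.dim H * (CARD('a) - 1))"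
  proof -
    have gH: "vec.subspace g" "g \<in> P" "vec.dim g = vec.dim H + 1" "H \<subseteq> g" if "g \<in> ?S" for g
      using that Gen_D dimH by auto
    have Int: "g \<inter> g' = H" if "g \<in> Gen" "H \<subseteq> g" "g' \<in> Gen" "H \<subseteq> g'" "g \<noteq> g'" for g g'
    proof -
      have "\<not> g \<subseteq> g'" using that Gen_eqI Gen_D(1) by blast
      hence "vec.dim (g \<inter> g') < vec.dim g" using that Gen_D
        by (intro dim_strict_mono vec.subspace_inter) auto
      thus ?thesis using that Gen_D dimH subH
        by (intro vec.subspace_dim_equal[symmetric] vec.subspace_inter) auto
    qed
    have "W \<inter> I = (\<Union>g\<in>?S. g - H)"
    proof (intro equalityI subsetI)
      fix v assume v: "v \<in> W \<inter> I"
      have "v \<notin> x" using v P_D(3)[OF Gen_D(1)[OF x(1)]] by (auto simp: W_def)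
      hence "v \<notin> H" using x by blast
      let ?g = "subspace_sum H (vec.span {v})"
      have "vec.span {v} \<subseteq> perp H" using v W subspace_perp by (intro vec.span_minimal) auto
      hence gP: "?g \<in> P" using v by (intro sum_in_P H span_singleton_in_P) auto
      have up: "H \<subseteq> ?g" "v \<in> ?g" using subspace_sum_upper[of H "vec.span {v}"] subH
        vec.span_base[of v "{v}"] by auto
      hence "vec.dim H < vec.dim ?g" using \<open>v \<notin> H\<close> subH P_D(1)[OF gP]
        by (intro dim_strict_mono) auto
      hence "?g \<in> Gen" using dim_le_rank[OF gP] dimH gP by (intro Gen_I) auto
      hence "?g \<in> ?S" using up \<open>v \<notin> x\<close> by auto
      thus "v \<in> (\<Union>g\<in>?S. g - H)" using up \<open>v \<notin> H\<close> by blast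
    next
      fix v assume "v \<in> (\<Union>g\<in>?S. g - H)"
      then obtain g where g: "g \<in> ?S" "v \<in> g" "v \<notin> H" by blast
      have "v \<in> perp H" using g gH(4)[OF g(1)] P_D(3)[OF gH(2)[OF g(1)]] perp_antimono by blast
      moreover have "v \<in> I" using g P_D(2)[OF gH(2)[OF g(1)]] by blast
      moreover have "v \<notin> x" using Int[of g x] g x by auto
      ultimately show "v \<in> W \<inter> I" using Gen_maximal[OF x(1)] by (auto simp: W_def)
    qed
    moreover have "\<forall>g\<in>?S. \<forall>g'\<in>?S. g \<noteq> g' \<longrightarrow> (g - H) \<inter> (g' - H) = {}"
      using Int by blast
    ultimately have "card (W \<inter> I) = (\<Sum>g\<in>?S. card (g - H))"
      by (simp only:) (intro card_UN_disjoint; simp)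
    also have "\<dots> = (\<Sum>g\<in>?S. CARD('a) ^ vec.dim H * (CARD('a) - 1))"
    proof (rule sum.cong[OF refl])
      fix g assume "g \<in> ?S"
      from gH[OF this] show "card (g - H) = CARD('a) ^ vec.dim H * (CARD('a) - 1)"
        using subH by (simp add: card_Diff_subset card_subspace algebra_simps)
    qed
    finally show ?thesis by simp
  qed
  ultimately have eq: "CARD('a) * (card ?S * (CARD('a) ^ vec.dim H * (CARD('a) - 1)))
      = c * (CARD('a) ^ (d + m) * (CARD('a) - 1))" by simp
  have "CARD('a) ^ d * card ?S * (CARD('a) - 1) = CARD('a) * (card ?S * (CARD('a) ^ vec.dim H * (CARD('a) - 1)))"
    by (simp flip: dimH)
  also have "\<dots> = CARD('a) ^ d * \<gamma> * (CARD('a) - 1)"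
    unfolding eq by (simp add: order_eq power_add)
  finally have "CARD('a) ^ d * card ?S * (CARD('a) - 1) = CARD('a) ^ d * \<gamma> * (CARD('a) - 1)" .
  thus ?thesis using two_le_card_field[where 'a='a] by simp
qed

end

section \<open>Counting opposite generators\<close>

definition opposite_count :: "nat \<Rightarrow> nat \<Rightarrow> nat \<Rightarrow> nat" where
  "opposite_count g q k = g ^ k * q ^ (k choose 2)"

lemma opposite_count_0 [simp]: "opposite_count g q 0 = 1"
  and opposite_count_Suc: "opposite_count g q (Suc k) = g * q ^ k * opposite_count g q k"
  by (simp_all add: opposite_count_def numeral_2_eq_2 power_add)

context polar_space_form
begin

lemma distinct_Gen_Int:
  assumes "x \<in> Gen" "y \<in> Gen" "x \<noteq> y" "vec.subspace G" "G \<subseteq> x" "G \<subseteq> y" "d = vec.dim G + 1"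
  shows "x \<inter> y = G"
proof -
  have "\<not> x \<subseteq> y" using assms Gen_eqI Gen_D(1) by blast
  hence "vec.dim (x \<inter> y) < vec.dim x"
    using assms Gen_D by (intro dim_strict_mono vec.subspace_inter) auto
  thus ?thesis
    using assms Gen_D
    by (intro vec.subspace_dim_equal[symmetric] vec.subspace_inter) auto
qed

text \<open>This is the valency of the disjointness graph in the residue of \<open>U\<close>, which has rank \<open>k\<close>. For the
  recursion choose a hyperplane \<open>G\<close> of \<open>x\<close> above \<open>U\<close>. A generator \<open>y\<close> with \<open>y \<inter> x = U\<close> determines the
  generator \<open>z = proj G y\<close>, which contains \<open>G\<close> and differs from \<open>x\<close>, and the subspace
  \<open>T = y \<inter> z\<close>, which covers \<open>U\<close> and does not lie in \<open>G\<close>. Conversely, every \<open>y\<close> with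
  \<open>y \<inter> z = T\<close> arises from \<open>(z, T)\<close> in this way. There are \<open>\<gamma>\<close> choices for \<open>z\<close>, then \<open>q ^ k\<close>
  for \<open>T\<close>, and \<open>T\<close> has residue of rank \<open>k\<close> if \<open>U\<close> has residue of rank \<open>Suc k\<close>.\<close>

lemma card_opposite:
  assumes x: "x \<in> Gen" and U: "vec.subspace U" "U \<subseteq> x" and dimU: "vec.dim U + k = d"
  shows "card {y \<in> Gen. y \<inter> x = U} = opposite_count \<gamma> CARD('a) k"
  using assms
proof (induction k arbitrary: x U)
  case 0
  have "U = x" using 0 Gen_D[of x] by (intro vec.subspace_dim_equal) auto
  hence "{y \<in> Gen. y \<inter> x = U} = {x}"
    using 0 Gen_eqI Gen_D(1) by blast
  thus ?case by simp
next
  case (Suc k)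
  note x = \<open>x \<in> Gen\<close> and U = \<open>vec.subspace U\<close> \<open>U \<subseteq> x\<close>
  note xD = Gen_D[OF x]
  have "U \<noteq> x" using Suc.prems xD by auto
  then obtain G where G: "vec.subspace G" "U \<subseteq> G" "G \<subseteq> x" "vec.dim x = vec.dim G + 1"
    using obtain_hyperplane_above[OF U(1) xD(3)] U(2) by blast
  have GP: "G \<in> P" using P_subspace xD G by blast
  have dimG: "d = vec.dim G + 1" using G xD by simp
  define Zs where "Zs = {z \<in> Gen. G \<subseteq> z \<and> z \<noteq> x}"
  define opp where "opp = (\<lambda>z T. {y \<in> Gen. y \<inter> z = T})"
  have z_perp: "z \<subseteq> perp G" if "z \<in> Zs" for z
    using that P_D(3)[OF Gen_D(1)] perp_antimono unfolding Zs_def by blast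
  have dim_perp: "vec.dim (y \<inter> perp G) = vec.dim U + 1" if "y \<in> Gen" "G \<inter> y = U" for y
    using dim_Int_perp_Gen[OF GP that(1)] that(2) dimG by simp
  have sound: "y \<inter> x = U \<and> z = proj G y"
    if z: "z \<in> Zs" and T: "T \<in> covers_off U G z" and y: "y \<in> opp z T" for z T y
  proof -
    have zD: "z \<in> Gen" "G \<subseteq> z" "z \<noteq> x" using z by (auto simp: Zs_def)
    have yD: "y \<in> Gen" "y \<inter> z = T" using y by (auto simp: opp_def)
    have TD: "vec.subspace T" "U \<subseteq> T" "vec.dim T = vec.dim U + 1" "\<not> T \<subseteq> G"
      using T by (auto simp: covers_off_def)
    have "T \<inter> G = U" using covers_off_Int[OF U(1) G(1,2) T] .
    hence Gy: "G \<inter> y = U" using yD zD by blast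
    have "T \<subseteq> y \<inter> perp G" using yD z_perp[OF z] by blast
    hence perp: "y \<inter> perp G = T"
      using TD dim_perp[OF yD(1) Gy] Gen_D(3)[OF yD(1)] subspace_perp
      by (intro vec.subspace_dim_equal[symmetric] vec.subspace_inter) auto
    have "proj G y \<subseteq> z" using perp yD zD Gen_D(3) by (intro proj_least) auto
    hence "proj G y = z"
      using Gen_eqI proj_in_Gen[OF GP yD(1)] Gen_D(1) zD(1) by blast
    moreover have "y \<inter> x = U"
    proof -
      have "x \<inter> z = G" using distinct_Gen_Int[OF x zD(1)] zD G dimG by blast
      moreover have "x \<subseteq> perp G" using P_D(3)[OF xD(1)] perp_antimono[OF G(3)] by blast
      ultimately have "y \<inter> x \<subseteq> G" using perp yD by blast
      thus ?thesis using Gy G by blast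
    qed
    ultimately show ?thesis by simp
  qed
  have complete: "\<exists>z\<in>Zs. \<exists>T\<in>covers_off U G z. y \<in> opp z T"
    if y: "y \<in> Gen" "y \<inter> x = U" for y
  proof -
    let ?z = "proj G y"
    have Gy: "G \<inter> y = U" using y G by blast
    have zG: "?z \<in> Gen" "G \<subseteq> ?z" using proj_in_Gen[OF GP y(1)] proj_upper[OF GP y(1)] by auto
    have "?z \<subseteq> perp G" using P_D(3)[OF Gen_D(1)[OF zG(1)]] perp_antimono[OF zG(2)] by blast
    hence yz: "y \<inter> ?z = y \<inter> perp G" using proj_upper(2)[OF GP y(1)] by blast
    have sub: "vec.subspace (y \<inter> ?z)" using Gen_D(3) y zG by (intro vec.subspace_inter) auto
    have dim: "vec.dim (y \<inter> ?z) = vec.dim U + 1" using dim_perp[OF y(1) Gy] yz by simp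
    have "\<not> y \<inter> ?z \<subseteq> x"
    proof
      assume "y \<inter> ?z \<subseteq> x"
      hence "y \<inter> ?z \<subseteq> U" using y by blast
      thus False using vec.dim_subset[of "y \<inter> ?z" U] dim by simp
    qed
    hence "?z \<in> Zs" "\<not> y \<inter> ?z \<subseteq> G" using zG G by (auto simp: Zs_def)
    moreover have "U \<subseteq> y \<inter> ?z" using Gy zG by blast
    ultimately show ?thesis
      using sub dim y(1) by (intro bexI[of _ ?z] bexI[of _ "y \<inter> ?z"]) (auto simp: covers_off_def opp_def)
  qed
  have "{y \<in> Gen. y \<inter> x = U} = (\<Union>z\<in>Zs. \<Union>T\<in>covers_off U G z. opp z T)"
    using sound complete by (auto simp: opp_def)
  also have "card \<dots> = (\<Sum>z\<in>Zs. card (\<Union>T\<in>covers_off U G z. opp z T))"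
    using sound by (intro card_UN_disjoint) (simp, simp, blast)
  also have "\<dots> = (\<Sum>z\<in>Zs. CARD('a) ^ k * opposite_count \<gamma> CARD('a) k)"
  proof (rule sum.cong[OF refl])
    fix z assume z: "z \<in> Zs"
    hence zD: "z \<in> Gen" "G \<subseteq> z" by (auto simp: Zs_def)
    have "card (\<Union>T\<in>covers_off U G z. opp z T) = (\<Sum>T\<in>covers_off U G z. card (opp z T))"
      by (rule card_UN_disjoint) (auto simp: opp_def)
    also have "\<dots> = (\<Sum>T\<in>covers_off U G z. opposite_count \<gamma> CARD('a) k)"
      using Suc.prems zD unfolding opp_def
      by (intro sum.cong refl Suc.IH) (auto simp: covers_off_def)
    also have "\<dots> = CARD('a) ^ k * opposite_count \<gamma> CARD('a) k"
    proof -
      have "vec.dim G - vec.dim U = k" using Suc.prems(4) dimG by simp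
      thus ?thesis
        using card_covers_off[OF U(1) G(1) Gen_D(3)[OF zD(1)] G(2) zD(2)] Gen_D(2)[OF zD(1)] dimG
        by simp
    qed
    finally show "card (\<Union>T\<in>covers_off U G z. opp z T) = CARD('a) ^ k * opposite_count \<gamma> CARD('a) k" .
  qed
  also have "\<dots> = \<gamma> * CARD('a) ^ k * opposite_count \<gamma> CARD('a) k"
    using card_Gen_above_corank1[OF GP _ x G(3)] dimG unfolding Zs_def by simp
  finally show ?case by (simp add: opposite_count_Suc)
qed

text \<open>A generator through \<open>U\<close> is disjoint from \<open>x\<close> if and only if it is opposite to the projection of
  \<open>x\<close> in the residue of \<open>U\<close>.\<close>

lemma card_Gen_above_opposite:
  assumes U: "U \<in> P" and x: "x \<in> Gen" and Ux: "U \<inter> x = {0}"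
  shows "card {y \<in> Gen. U \<subseteq> y \<and> y \<inter> x = {0}} = opposite_count \<gamma> CARD('a) (d - vec.dim U)"
proof -
  note z = proj_in_Gen[OF U x] and up = proj_upper[OF U x]
  have sub: "vec.subspace U" "vec.subspace x" using P_D(1)[OF U] Gen_D(3)[OF x] by auto
  have iff: "U \<subseteq> y \<and> y \<inter> x = {0} \<longleftrightarrow> y \<inter> proj U x = U" if y: "y \<in> Gen" for y
  proof
    assume A: "U \<subseteq> y \<and> y \<inter> x = {0}"
    have "v \<in> U" if v: "v \<in> y" "v \<in> proj U x" for v
    proof -
      obtain u w where uw: "v = u + w" "u \<in> U" "w \<in> x" using v(2) by (auto simp: proj_def)
      have "w = v - u" using uw by simp
      moreover have "u \<in> y" using A uw by blast
      ultimately have "w \<in> y" using v(1) vec.subspace_diff[OF Gen_D(3)[OF y]] by simp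
      hence "w = 0" using A uw by blast
      thus ?thesis using uw by simp
    qed
    hence "y \<inter> proj U x \<subseteq> U" by blast
    thus "y \<inter> proj U x = U" using A up(1) by blast
  next
    assume A: "y \<inter> proj U x = U"
    hence Uy: "U \<subseteq> y" by blast
    hence "y \<subseteq> perp U" using P_D(3)[OF Gen_D(1)[OF y]] perp_antimono by blast
    hence "y \<inter> x \<subseteq> U" using A up by blast
    hence "y \<inter> x \<subseteq> {0}" using Ux by blast
    moreover have "0 \<in> y \<inter> x" using Gen_D(3)[OF y] sub by (simp add: vec.subspace_0)
    ultimately show "U \<subseteq> y \<and> y \<inter> x = {0}" using Uy by blast
  qed
  have "{y \<in> Gen. U \<subseteq> y \<and> y \<inter> x = {0}} = {y \<in> Gen. y \<inter> proj U x = U}"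
    by (intro Collect_cong conj_cong refl iff)
  thus ?thesis using card_opposite[OF z sub(1) up(1)] dim_le_rank[OF U] by simp
qed

lemma card_disjoint:
  assumes "x \<in> Gen" shows "card {y \<in> Gen. y \<inter> x = {0}} = opposite_count \<gamma> CARD('a) d"
  using card_opposite[OF assms, of "{0}" d] Gen_D(3)[OF assms] by (simp add: vec.subspace_0)

text \<open>Count the disjoint pairs \<open>(x, y)\<close> of generators with \<open>x\<close> through the point \<open>U\<close>. This relates
  the number of generators through a point to the number of all generators, in just the form in
  which the ratio bound needs it.\<close>

lemma pencil_double_count:
  assumes U: "U \<in> points P"
  shows "card {x \<in> Gen. U \<subseteq> x} * opposite_count \<gamma> CARD('a) d = (card Gen - card {x \<in> Gen. U \<subseteq> x}) * opposite_count \<gamma> CARD('a) (d - 1)"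
proof -
  have UP: "U \<in> P" and dim: "vec.dim U = 1" using U by (auto simp: points_def)
  let ?N = "{x \<in> Gen. \<not> U \<subseteq> x}"
  have Int: "U \<inter> x = {0}" if "x \<in> Gen" "\<not> U \<subseteq> x" for x
  proof -
    have sub: "vec.subspace (U \<inter> x)" using P_D(1)[OF UP] Gen_D(3)[OF that(1)] by (rule vec.subspace_inter)
    have "vec.dim (U \<inter> x) < vec.dim U" using that P_D(1)[OF UP] sub by (intro dim_strict_mono) auto
    hence "U \<inter> x \<subseteq> {0}" using dim by simp
    thus ?thesis using vec.subspace_0[OF sub] by blast
  qed
  have "card {x \<in> Gen. U \<subseteq> x} * opposite_count \<gamma> CARD('a) d = (\<Sum>x | x \<in> Gen \<and> U \<subseteq> x. card {y \<in> Gen. y \<inter> x = {0}})"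
    by (simp add: card_disjoint)
  also have "\<dots> = (\<Sum>x | x \<in> Gen \<and> U \<subseteq> x. \<Sum>y\<in>Gen. if y \<inter> x = {0} then 1 else 0)"
    by (simp add: sum.If_cases Int_def)
  also have "\<dots> = (\<Sum>y\<in>Gen. \<Sum>x | x \<in> Gen \<and> U \<subseteq> x. if y \<inter> x = {0} then 1 else 0)"
    by (rule sum.swap)
  also have "\<dots> = (\<Sum>y\<in>Gen. card {x \<in> Gen. U \<subseteq> x \<and> x \<inter> y = {0}})"
    by (simp add: sum.If_cases Int_def conj_ac)
  also have "\<dots> = (\<Sum>y\<in>Gen. if U \<subseteq> y then 0 else opposite_count \<gamma> CARD('a) (d - 1))"
  proof (rule sum.cong[OF refl])
    fix y assume y: "y \<in> Gen"
    show "card {x \<in> Gen. U \<subseteq> x \<and> x \<inter> y = {0}} = (if U \<subseteq> y then 0 else opposite_count \<gamma> CARD('a) (d - 1))"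
    proof (cases "U \<subseteq> y")
      case True
      have "U \<noteq> {0}" using dim by auto
      moreover have "0 \<in> U" using P_D(1)[OF UP] by (rule vec.subspace_0)
      ultimately have "{x \<in> Gen. U \<subseteq> x \<and> x \<inter> y = {0}} = {}" using True by auto
      thus ?thesis using True by simp
    next
      case False
      thus ?thesis using card_Gen_above_opposite[OF UP y Int[OF y False]] dim by simp
    qed
  qed
  also have "\<dots> = card ?N * opposite_count \<gamma> CARD('a) (d - 1)"
    by (simp add: sum.If_cases Int_def)
  also have "?N = Gen - {x \<in> Gen. U \<subseteq> x}" by blast
  also have "card \<dots> = card Gen - card {x \<in> Gen. U \<subseteq> x}" by (rule card_Diff_subset) auto
  finally show ?thesis .
qed

end

section \<open>Symmetric operators and the ratio bound\<close>

text \<open>A symmetric operator that respects a filtration, and acts on its \<open>j\<close>-th quotient as the scalar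
  \<open>l j\<close>, acts as \<open>l j\<close> on the orthogonal complement of each step in the next one. Hence its Rayleigh
  quotients on the complement of the first step are averages of the \<open>l j\<close> with \<open>j \<ge> 1\<close>. The bounds
  follow by induction on the filtration, splitting off the component orthogonal to the previous step.\<close>

lemma filtered_selfadjoint_bounds:
  fixes A :: "'v::euclidean_space \<Rightarrow> 'v" and F :: "nat \<Rightarrow> 'v set" and l :: "nat \<Rightarrow> real"
  assumes A: "linear A" and selfadjoint: "\<And>x y. A x \<bullet> y = x \<bullet> A y"
    and subspace: "\<And>j. subspace (F j)" and mono: "\<And>i j. i \<le> j \<Longrightarrow> F i \<subseteq> F j"
    and F0: "F 0 = {0}"
    and step: "\<And>j x. x \<in> F (Suc j) \<Longrightarrow> A x - l j *\<^sub>R x \<in> F j"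
    and bounds: "\<And>j. 1 \<le> j \<Longrightarrow> j \<le> n \<Longrightarrow> - \<mu> \<le> l j \<and> l j < \<mu>"
    and x: "x \<in> F (Suc n)" "\<And>w. w \<in> F 1 \<Longrightarrow> x \<bullet> w = 0"
  shows "- \<mu> * (x \<bullet> x) \<le> x \<bullet> A x \<and> (x \<noteq> 0 \<longrightarrow> x \<bullet> A x < \<mu> * (x \<bullet> x))"
  using bounds x
proof (induction n arbitrary: x)
  case 0
  hence "x = 0" by (metis One_nat_def inner_eq_zero_iff)
  thus ?case using linear_0[OF A] by simp
next
  case (Suc n)
  have inv: "A v \<in> F (Suc j)" if "v \<in> F (Suc j)" for v j
  proof -
    have "A v - l j *\<^sub>R v \<in> F (Suc j)" using step[OF that] mono[of j "Suc j"] by auto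
    hence "A v - l j *\<^sub>R v + l j *\<^sub>R v \<in> F (Suc j)"
      using that subspace by (intro subspace_add subspace_scale) auto
    thus ?thesis by simp
  qed
  let ?l = "l (Suc n)"
  obtain y z where "y \<in> span (F (Suc n))" and "\<And>w. w \<in> span (F (Suc n)) \<Longrightarrow> orthogonal z w"
    and xyz: "x = y + z"
    using orthogonal_subspace_decomp_exists[of "F (Suc n)" x] by blast
  hence y: "y \<in> F (Suc n)" and z: "\<And>w. w \<in> F (Suc n) \<Longrightarrow> z \<bullet> w = 0"
    using subspace by (auto simp: span_eq_iff[THEN iffD2] orthogonal_def)
  have "z \<in> F (Suc (Suc n))"
    using subspace_diff[OF subspace, of x "Suc (Suc n)" y] Suc.prems(2) y mono[of "Suc n" "Suc (Suc n)"] xyz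
    by auto
  hence r: "A z - ?l *\<^sub>R z \<in> F (Suc n)" by (rule step)
  have "(A z - ?l *\<^sub>R z) \<bullet> w = 0" if "w \<in> F (Suc n)" for w
    using z[OF that] z[OF inv[OF that]] by (simp add: inner_diff_left selfadjoint)
  hence "(A z - ?l *\<^sub>R z) \<bullet> (A z - ?l *\<^sub>R z) = 0" using r by blast
  hence Az: "A z = ?l *\<^sub>R z" by simp
  have yz: "y \<bullet> z = 0" "z \<bullet> y = 0" using z[OF y] by (simp_all add: inner_commute)
  have zAy: "z \<bullet> A y = 0" using z[OF inv[OF y]] .
  have xx: "x \<bullet> x = y \<bullet> y + z \<bullet> z" by (simp add: xyz inner_add yz)
  have xAx: "x \<bullet> A x = y \<bullet> A y + ?l * (z \<bullet> z)"
    by (simp add: xyz linear_add[OF A] inner_add Az yz zAy)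
  have "y \<bullet> w = 0" if w: "w \<in> F 1" for w
  proof -
    have "z \<bullet> w = 0" using z mono[of 1 "Suc n"] w by auto
    thus ?thesis using Suc.prems(3)[OF w] by (simp add: xyz inner_add_left)
  qed
  hence IH: "- \<mu> * (y \<bullet> y) \<le> y \<bullet> A y \<and> (y \<noteq> 0 \<longrightarrow> y \<bullet> A y < \<mu> * (y \<bullet> y))"
    using Suc.IH[of y] Suc.prems(1) y by auto
  have l: "- \<mu> \<le> ?l" "?l < \<mu>" using Suc.prems(1)[of "Suc n"] by auto
  have z_lower: "- \<mu> * (z \<bullet> z) \<le> ?l * (z \<bullet> z)" using l by (intro mult_right_mono) auto
  have z_upper: "?l * (z \<bullet> z) \<le> \<mu> * (z \<bullet> z)" using l by (intro mult_right_mono) auto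
  have z_strict: "?l * (z \<bullet> z) < \<mu> * (z \<bullet> z)" if "z \<noteq> 0"
    using l that by (intro mult_strict_right_mono) auto
  have y_upper: "y \<bullet> A y \<le> \<mu> * (y \<bullet> y)" using IH by (cases "y = 0") auto
  show ?case
  proof (intro conjI impI)
    show "- \<mu> * (x \<bullet> x) \<le> x \<bullet> A x"
      unfolding xAx xx ring_distribs using IH z_lower by linarith
    assume "x \<noteq> 0"
    hence "y \<noteq> 0 \<or> z \<noteq> 0" using xyz by auto
    thus "x \<bullet> A x < \<mu> * (x \<bullet> x)"
      unfolding xAx xx ring_distribs using IH y_upper z_upper z_strict by linarith
  qed
qed

text \<open>Here \<open>e\<close> is the all-one vector and \<open>f\<close>, \<open>g\<close> are the indicator vectors of two sets of sizes \<open>\<alpha>\<close>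
  and \<open>\<beta>\<close> without edges between them. Scale the components orthogonal to \<open>e\<close> to
  \<open>u = f / sqrt \<alpha> - \<dots>\<close> and \<open>w = g / sqrt \<beta> - \<dots>\<close>, and polarise: \<open>4 * (u \<bullet> A w)\<close> is the difference of
  the quadratic form of \<open>A\<close> at \<open>u + w\<close> and at \<open>u - w\<close>, where the spectral bounds apply. The total
  slack in these bounds equals \<open>- 2 * \<mu> * (sqrt \<alpha> - sqrt \<beta>)\<^sup>2 / n\<close>, so there is none: \<open>\<alpha> = \<beta>\<close>, and
  \<open>u = w\<close> because the upper bound is strict.\<close>

lemma cross_ratio_bound_equality:
  fixes A :: "'v::real_inner \<Rightarrow> 'v"
  assumes A: "linear A" and selfadjoint: "\<And>x y. A x \<bullet> y = x \<bullet> A y"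
    and e: "e \<bullet> e = n" "A e = k *\<^sub>R e"
    and f: "f \<bullet> f = \<alpha>" "f \<bullet> e = \<alpha>" and g: "g \<bullet> g = \<beta>" "g \<bullet> e = \<beta>"
    and fAg: "f \<bullet> A g = 0"
    and lower: "\<And>x. x \<in> span {e, f, g} \<Longrightarrow> x \<bullet> e = 0 \<Longrightarrow> - \<mu> * (x \<bullet> x) \<le> x \<bullet> A x"
    and upper: "\<And>x. x \<in> span {e, f, g} \<Longrightarrow> x \<bullet> e = 0 \<Longrightarrow> x \<noteq> 0 \<Longrightarrow> x \<bullet> A x < \<mu> * (x \<bullet> x)"
    and pos: "0 < b" "0 < \<mu>" "0 < n" and kb: "k * b = \<mu> * (n - b)" and \<alpha>\<beta>: "sqrt (\<alpha> * \<beta>) = b"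
  shows "f = g"
proof -
  have "0 \<le> \<alpha>" "0 \<le> \<beta>" using f(1) g(1) by (metis inner_ge_zero)+
  hence \<alpha>: "0 < \<alpha>" and \<beta>: "0 < \<beta>" using \<alpha>\<beta> pos(1) by (auto simp: less_le)
  define s t where "s = sqrt \<alpha>" and "t = sqrt \<beta>"
  have st: "0 < s" "0 < t" "\<alpha> = s\<^sup>2" "\<beta> = t\<^sup>2" "s * t = b"
    using \<alpha> \<beta> \<alpha>\<beta> by (auto simp: s_def t_def real_sqrt_mult)
  define u w where "u = (1 / s) *\<^sub>R f - (s / n) *\<^sub>R e" and "w = (1 / t) *\<^sub>R g - (t / n) *\<^sub>R e"
  have Ae: "f \<bullet> A e = k * \<alpha>" "e \<bullet> A e = k * n" "e \<bullet> A g = k * \<beta>"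
    using f g e by (simp_all flip: selfadjoint) (simp add: inner_commute)
  have ef: "e \<bullet> f = \<alpha>" "e \<bullet> g = \<beta>" using f g by (simp_all add: inner_commute)
  have ue: "u \<bullet> e = 0" "w \<bullet> e = 0"
    using st pos f g e by (simp_all add: u_def w_def inner_diff_left power2_eq_square)
  have uu: "u \<bullet> u = 1 - \<alpha> / n" "w \<bullet> w = 1 - \<beta> / n"
    using st pos by (simp_all add: u_def w_def inner_diff f g e ef power2_eq_square field_simps)
  \<comment> \<open>this is where \<open>f \<bullet> A g = 0\<close> enters\<close>
  have uAw: "u \<bullet> A w = - (k * b / n)"
    using st pos by (simp add: u_def w_def linear_diff[OF A] linear_scale[OF A] inner_diff Ae fAg
        power2_eq_square field_simps)
  have span: "u \<in> span {e, f, g}" "w \<in> span {e, f, g}"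
    unfolding u_def w_def by (intro span_diff span_scale span_base; simp)+
  have wAu: "w \<bullet> A u = u \<bullet> A w" by (metis selfadjoint inner_commute)
  have polar: "4 * (u \<bullet> A w) = (u + w) \<bullet> A (u + w) - (u - w) \<bullet> A (u - w)"
    by (simp add: linear_add[OF A] linear_diff[OF A] inner_add inner_diff wAu)
  have para: "(u + w) \<bullet> (u + w) + (u - w) \<bullet> (u - w) = 4 - 2 * (\<alpha> + \<beta>) / n"
    by (simp add: inner_add inner_diff uu inner_commute add_divide_distrib)
  have plus: "- \<mu> * ((u + w) \<bullet> (u + w)) \<le> (u + w) \<bullet> A (u + w)"
    using span ue by (intro lower span_add) (simp_all add: inner_add_left)
  have minus: "(u - w) \<bullet> A (u - w) \<le> \<mu> * ((u - w) \<bullet> (u - w))"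
    and minus_strict: "u \<noteq> w \<Longrightarrow> (u - w) \<bullet> A (u - w) < \<mu> * ((u - w) \<bullet> (u - w))"
    using upper[of "u - w"] span ue linear_0[OF A]
    by (cases "u = w"; simp add: span_diff inner_diff_left less_imp_le)+
  have amgm: "2 * b + (s - t)\<^sup>2 = \<alpha> + \<beta>" using st by (simp add: power2_eq_square algebra_simps)
  have "4 * (u \<bullet> A w) + \<mu> * (4 - 2 * (\<alpha> + \<beta>) / n)
      = ((u + w) \<bullet> A (u + w) + \<mu> * ((u + w) \<bullet> (u + w)))
        + (\<mu> * ((u - w) \<bullet> (u - w)) - (u - w) \<bullet> A (u - w))"
    unfolding polar para[symmetric] by (simp add: algebra_simps)
  moreover have "4 * (u \<bullet> A w) + \<mu> * (4 - 2 * (\<alpha> + \<beta>) / n) = - (2 * \<mu> * (s - t)\<^sup>2 / n)"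
    using pos unfolding uAw amgm[symmetric] kb by (simp add: field_simps)
  ultimately have key: "((u + w) \<bullet> A (u + w) + \<mu> * ((u + w) \<bullet> (u + w)))
        + (\<mu> * ((u - w) \<bullet> (u - w)) - (u - w) \<bullet> A (u - w)) = - (2 * \<mu> * (s - t)\<^sup>2 / n)" by simp
  have nonneg: "0 \<le> 2 * \<mu> * (s - t)\<^sup>2 / n" using pos by simp
  have "u = w" using key nonneg plus minus_strict by fastforce
  moreover have "s = t"
  proof -
    have "2 * \<mu> * (s - t)\<^sup>2 / n \<le> 0" using key plus minus by linarith
    hence "2 * \<mu> * (s - t)\<^sup>2 / n = 0" using nonneg by linarith
    thus ?thesis using pos by simp
  qed
  ultimately show ?thesis using st(1) by (simp add: u_def w_def)
qed


context polar_space_form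
begin

section \<open>The spectrum of the disjointness graph\<close>

definition ind :: "('a ^ 'n) set set \<Rightarrow> real ^ (('a ^ 'n) set)" where
  "ind S = (\<chi> x. if x \<in> S then 1 else 0)"

abbreviation pencil :: "('a ^ 'n) set \<Rightarrow> ('a ^ 'n) set set" where
  "pencil U \<equiv> {g \<in> Gen. U \<subseteq> g}"

text \<open>The steps of the filtration. The strict inequality makes \<open>lower_span 0\<close> trivial and
  \<open>lower_span 1\<close> the space of constants.\<close>

definition lower_span :: "nat \<Rightarrow> (real ^ (('a ^ 'n) set)) set" where
  "lower_span j = span {ind (pencil U) | U. U \<in> P \<and> vec.dim U < j}"

definition disjointness :: "real ^ (('a ^ 'n) set) \<Rightarrow> real ^ (('a ^ 'n) set)" where
  "disjointness v = (\<chi> x. if x \<in> Gen then \<Sum>y | y \<in> Gen \<and> y \<inter> x = {0}. v $ y else 0)"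

lemma lower_span_mono: "i \<le> j \<Longrightarrow> lower_span i \<subseteq> lower_span j"
  unfolding lower_span_def by (intro span_mono) auto

lemma subspace_lower_span: "subspace (lower_span j)"
  unfolding lower_span_def by (rule subspace_span)

lemma pencil_in_lower_span: "U \<in> P \<Longrightarrow> vec.dim U < j \<Longrightarrow> ind (pencil U) \<in> lower_span j"
  unfolding lower_span_def by (rule span_base) blast

text \<open>Moebius inversion in the lattice of subspaces between \<open>S\<close> and \<open>U\<close>, keeping only the leading term.
  Let \<open>G\<close> be a hyperplane of \<open>U\<close> above \<open>S\<close>. A generator with \<open>g \<inter> G = S\<close> meets \<open>U\<close>
  either in \<open>S\<close> or in one of the \<open>q ^ k\<close> covers of \<open>S\<close> off \<open>G\<close>. The set of these generators
  contributes only to the lower terms, as \<open>G\<close> has smaller dimension than \<open>U\<close>, so the leading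
  coefficient for \<open>S\<close> is \<open>- (q ^ k)\<close> times that for a cover.\<close>

lemma meet_pencil_mod_lower_span:
  assumes "U \<in> P" "vec.subspace S" "S \<subseteq> U" "vec.dim S + k = vec.dim U"
  shows "ind {g \<in> Gen. g \<inter> U = S} - ((-1) ^ k * real CARD('a) ^ (k choose 2)) *\<^sub>R ind (pencil U)
    \<in> lower_span (vec.dim U)"
  using assms
proof (induction k arbitrary: U S)
  case 0
  have "S = U" using 0 P_D(1) by (intro vec.subspace_dim_equal) auto
  hence "{g \<in> Gen. g \<inter> U = S} = pencil U" by blast
  thus ?case using subspace_0[OF subspace_lower_span] by (simp add: numeral_2_eq_2)
next
  case (Suc k)
  note U = \<open>U \<in> P\<close> and S = \<open>vec.subspace S\<close> \<open>S \<subseteq> U\<close>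
  note subU = P_D(1)[OF U]
  have "S \<noteq> U" using Suc.prems by auto
  then obtain G where G: "vec.subspace G" "S \<subseteq> G" "G \<subseteq> U" "vec.dim U = vec.dim G + 1"
    using obtain_hyperplane_above[OF S(1) subU] S(2) by blast
  have GP: "G \<in> P" using P_subspace U G by blast
  let ?C = "covers_off S G U" and ?c = "(-1) ^ k * real CARD('a) ^ (k choose 2)"
  let ?m = "\<lambda>U S. ind {g \<in> Gen. g \<inter> U = S}"
  have CD: "vec.subspace T" "S \<subseteq> T" "T \<subseteq> U" "vec.dim T = vec.dim S + 1" "\<not> T \<subseteq> G" if "T \<in> ?C" for T
    using that by (auto simp: covers_off_def)
  \<comment> \<open>the generators that meet \<open>G\<close> in \<open>S\<close>, sorted by their intersection with \<open>U\<close>\<close>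
  have split: "?m G S = ?m U S + (\<Sum>T\<in>?C. ?m U T)"
  proof -
    have pointwise: "(if g \<inter> G = S then 1 else 0)
        = (if g \<inter> U = S then 1 else 0) + (\<Sum>T\<in>?C. if g \<inter> U = T then 1 else (0::real))"
      if g: "g \<in> Gen" for g
    proof -
      have sub: "vec.subspace (g \<inter> U)" using Gen_D(3)[OF g] subU by (rule vec.subspace_inter)
      have gUG: "g \<inter> G = g \<inter> U \<inter> G" using G by blast
      have delta: "(\<Sum>T\<in>?C. if g \<inter> U = T then 1 else (0::real)) = (if g \<inter> U \<in> ?C then 1 else 0)"
        by simp
      show ?thesis
      proof (cases "g \<inter> U \<subseteq> G")
        case True
        hence "g \<inter> U = g \<inter> G" using G by blast
        moreover have "g \<inter> U \<notin> ?C" using True CD(5) by blast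
        ultimately show ?thesis unfolding delta by simp
      next
        case False
        have "vec.dim (g \<inter> U) = vec.dim (g \<inter> U \<inter> G) + 1"
          using Int_hyperplane_dim[OF sub G(1) _ G(3) subU G(4) False] by simp
        hence "g \<inter> G = S \<Longrightarrow> g \<inter> U \<in> ?C"
          using sub False gUG by (auto simp: covers_off_def)
        moreover have "g \<inter> U \<in> ?C \<Longrightarrow> g \<inter> G = S"
          using covers_off_Int[OF S(1) G(1,2)] gUG by simp
        moreover have "g \<inter> U \<noteq> S" using False G(2) by blast
        ultimately show ?thesis unfolding delta by auto
      qed
    qed
    have "?m G S $ g = (?m U S + (\<Sum>T\<in>?C. ?m U T)) $ g" for g
    proof (cases "g \<in> Gen")
      case True
      show ?thesis using pointwise[OF True] by (simp add: ind_def True)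
    qed (simp add: ind_def)
    thus ?thesis by (simp only: vec_eq_iff simp_thms)
  qed
  have "?m G S \<in> lower_span (vec.dim U)"
  proof -
    have "?m G S - ?c *\<^sub>R ind (pencil G) \<in> lower_span (vec.dim U)"
      using Suc.IH[OF GP S(1) G(2)] Suc.prems(4) G(4) lower_span_mono[of "vec.dim G" "vec.dim U"] by auto
    moreover have "?c *\<^sub>R ind (pencil G) \<in> lower_span (vec.dim U)"
      using pencil_in_lower_span[OF GP] G(4) by (intro subspace_scale subspace_lower_span) auto
    ultimately show ?thesis using subspace_add[OF subspace_lower_span] by fastforce
  qed
  moreover have "(\<Sum>T\<in>?C. ?m U T - ?c *\<^sub>R ind (pencil U)) \<in> lower_span (vec.dim U)"
    using Suc.IH[OF U] CD Suc.prems(4) by (intro subspace_sum subspace_lower_span) auto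
  ultimately have "?m G S - (\<Sum>T\<in>?C. ?m U T - ?c *\<^sub>R ind (pencil U)) \<in> lower_span (vec.dim U)"
    by (rule subspace_diff[OF subspace_lower_span])
  also have "?m G S - (\<Sum>T\<in>?C. ?m U T - ?c *\<^sub>R ind (pencil U))
      = ?m U S + (real (card ?C) * ?c) *\<^sub>R ind (pencil U)"
    unfolding split by (simp add: sum_subtractf sum_constant_scaleR del: sum_constant)
  also have "real (card ?C) * ?c = - ((-1) ^ Suc k * real CARD('a) ^ (Suc k choose 2))"
  proof -
    have "vec.dim G - vec.dim S = k" using Suc.prems(4) G(4) by simp
    hence "card ?C = CARD('a) ^ k" using card_covers_off[OF S(1) G(1) subU G(2,3,4)] by simp
    thus ?thesis by (simp add: numeral_2_eq_2 power_add)
  qed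
  finally show ?case by simp
qed

lemma linear_disjointness: "linear disjointness"
  by (rule linearI) (auto simp: disjointness_def vec_eq_iff sum.distrib sum_distrib_left)

lemma disjointness_nth:
  "disjointness v $ x = (\<Sum>y\<in>UNIV. if x \<in> Gen \<and> y \<in> Gen \<and> y \<inter> x = {0} then v $ y else 0)"
  by (simp add: disjointness_def sum.If_cases Int_def)

lemma disjointness_selfadjoint: "disjointness v \<bullet> w = v \<bullet> disjointness w"
proof -
  have "disjointness v \<bullet> w
      = (\<Sum>x\<in>UNIV. \<Sum>y\<in>UNIV. if x \<in> Gen \<and> y \<in> Gen \<and> y \<inter> x = {0} then v $ y * w $ x else 0)"
    by (simp add: inner_vec_def disjointness_nth sum_distrib_right if_distrib[of "\<lambda>a. a * _"] cong: if_cong)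
  also have "\<dots> = (\<Sum>y\<in>UNIV. \<Sum>x\<in>UNIV. if x \<in> Gen \<and> y \<in> Gen \<and> y \<inter> x = {0} then v $ y * w $ x else 0)"
    by (rule sum.swap)
  also have "\<dots> = v \<bullet> disjointness w"
    by (simp add: inner_vec_def disjointness_nth sum_distrib_left if_distrib[of "\<lambda>a. _ * a"] Int_commute conj_ac
        cong: if_cong)
  finally show ?thesis .
qed

lemma disjointness_pencil:
  assumes U: "U \<in> P"
  shows "disjointness (ind (pencil U))
    = real (opposite_count \<gamma> CARD('a) (d - vec.dim U)) *\<^sub>R ind {g \<in> Gen. g \<inter> U = {0}}"
proof -
  have "(\<Sum>y | y \<in> Gen \<and> y \<inter> x = {0}. if y \<in> Gen \<and> U \<subseteq> y then 1 else (0::real))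
      = real (opposite_count \<gamma> CARD('a) (d - vec.dim U)) * (if x \<inter> U = {0} then 1 else 0)"
    if x: "x \<in> Gen" for x
  proof -
    have "(\<Sum>y | y \<in> Gen \<and> y \<inter> x = {0}. if y \<in> Gen \<and> U \<subseteq> y then 1 else (0::real))
       = real (card {y \<in> Gen. U \<subseteq> y \<and> y \<inter> x = {0}})"
      by (simp add: sum.If_cases Int_def conj_ac)
    also have "\<dots> = real (opposite_count \<gamma> CARD('a) (d - vec.dim U)) * (if x \<inter> U = {0} then 1 else 0)"
    proof (cases "x \<inter> U = {0}")
      case True
      thus ?thesis using card_Gen_above_opposite[OF U x] by (simp add: Int_commute)
    next
      case False
      have "0 \<in> U \<inter> x" using P_D(1)[OF U] Gen_D(3)[OF x] by (simp add: vec.subspace_0)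
      hence "{y \<in> Gen. U \<subseteq> y \<and> y \<inter> x = {0}} = {}" using False by blast
      thus ?thesis using False by simp
    qed
    finally show ?thesis .
  qed
  thus ?thesis by (simp add: vec_eq_iff disjointness_def ind_def)
qed

text \<open>The eigenvalue on the \<open>j\<close>-th quotient of the filtration: the Moebius number of a space of
  dimension \<open>j\<close> times the valency of the disjointness graph of rank \<open>d - j\<close>.\<close>

definition eigval :: "nat \<Rightarrow> real" where
  "eigval j = (-1) ^ j * real CARD('a) ^ (j choose 2) * real (opposite_count \<gamma> CARD('a) (d - j))"

text \<open>Apply Moebius inversion to \<open>disjointness_pencil\<close>. A subspace \<open>U\<close> of dimension less than \<open>j\<close>
  contributes nothing modulo \<open>lower_span j\<close>, as its pencil already lies there.\<close>

lemma disjointness_eigval: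
  assumes "x \<in> lower_span (Suc j)"
  shows "disjointness x - eigval j *\<^sub>R x \<in> lower_span j"
proof -
  let ?h = "\<lambda>x. disjointness x - eigval j *\<^sub>R x"
  let ?k = "\<lambda>i. real (opposite_count \<gamma> CARD('a) (d - i))"
  have lin: "linear ?h"
    using linear_disjointness by (intro linear_compose_sub linear_compose_scale_right linear_id[unfolded id_def])
  have gen: "?h (ind (pencil U)) \<in> lower_span j" if U: "U \<in> P" "vec.dim U < Suc j" for U
  proof -
    let ?i = "vec.dim U" and ?D = "ind {g \<in> Gen. g \<inter> U = {0}}"
    let ?c = "(-1) ^ ?i * real CARD('a) ^ (?i choose 2)"
    have D: "?D - ?c *\<^sub>R ind (pencil U) \<in> lower_span ?i"
      using meet_pencil_mod_lower_span[OF U(1), of "{0}" ?i] P_D(1)[OF U(1)] by (simp add: vec.subspace_0)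
    have h: "?h (ind (pencil U)) = ?k ?i *\<^sub>R (?D - ?c *\<^sub>R ind (pencil U))
        + (?k ?i * ?c - eigval j) *\<^sub>R ind (pencil U)"
      by (simp add: disjointness_pencil[OF U(1)] algebra_simps)
    have "?k ?i *\<^sub>R (?D - ?c *\<^sub>R ind (pencil U)) \<in> lower_span j"
      using D lower_span_mono[of ?i j] U(2) by (intro subspace_scale subspace_lower_span) auto
    moreover have "(?k ?i * ?c - eigval j) *\<^sub>R ind (pencil U) \<in> lower_span j"
    proof (cases "?i = j")
      case True
      thus ?thesis using subspace_0[OF subspace_lower_span] by (simp add: eigval_def mult_ac)
    next
      case False
      thus ?thesis using U by (intro subspace_scale subspace_lower_span pencil_in_lower_span) auto
    qed
    ultimately show ?thesis unfolding h by (rule subspace_add[OF subspace_lower_span])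
  qed
  have "subspace {x. ?h x \<in> lower_span j}"
    using linear_subspace_vimage[OF lin subspace_lower_span] by (simp add: vimage_def)
  moreover have "{ind (pencil U) | U. U \<in> P \<and> vec.dim U < Suc j} \<subseteq> {x. ?h x \<in> lower_span j}"
    using gen by blast
  ultimately show ?thesis using assms span_minimal unfolding lower_span_def by blast
qed

text \<open>A generator is the only element of its own pencil, so the filtration ends with all functions on
  the generators.\<close>

lemma ind_in_lower_span:
  assumes "Y \<subseteq> Gen"
  shows "ind Y \<in> lower_span (Suc d)"
proof -
  have pencil_Gen: "pencil y = {y}" if "y \<in> Gen" for y
    using that Gen_eqI Gen_D(1) by blast
  have "ind Y = (\<Sum>y\<in>Y. ind {y})"
    by (simp add: vec_eq_iff ind_def)
  also have "\<dots> = (\<Sum>y\<in>Y. ind (pencil y))"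
    using assms by (intro sum.cong refl) (simp only: pencil_Gen subsetD)
  also have "\<dots> \<in> lower_span (Suc d)"
    using assms Gen_D by (intro subspace_sum subspace_lower_span pencil_in_lower_span) auto
  finally show ?thesis .
qed

text \<open>The ratio bound for the disjointness graph. The number \<open>\<mu>\<close> is kept as a parameter since it
  arises differently for hyperbolic quadrics and for the other polar spaces.\<close>

theorem cross_intersecting_equality:
  fixes b \<mu> :: real
  assumes cross: "cross_intersecting_EKR_set P Y Z"
    and size: "sqrt (real (card Y) * real (card Z)) = b"
    and pos: "0 < b" "0 < \<mu>"
    and ratio: "real (opposite_count \<gamma> CARD('a) d) * b = \<mu> * (real (card Gen) - b)"
    and bounds: "\<And>j. 1 \<le> j \<Longrightarrow> j \<le> d \<Longrightarrow> - \<mu> \<le> eigval j \<and> eigval j < \<mu>"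
  shows "Y = Z"
proof -
  have YZ: "Y \<subseteq> Gen" "Z \<subseteq> Gen" and meet: "\<And>y z. y \<in> Y \<Longrightarrow> z \<in> Z \<Longrightarrow> vec.dim (y \<inter> z) \<ge> 1"
    using cross by (auto simp: cross_intersecting_EKR_set_def)
  have pencil0: "pencil {0} = Gen" using Gen_D(3) vec.subspace_0 by auto
  have inner_ind: "ind S \<bullet> ind T = real (card (S \<inter> T))" for S T
  proof -
    have "(\<Sum>x\<in>UNIV. ind S $ x * ind T $ x) = (\<Sum>x\<in>UNIV. if x \<in> S \<inter> T then 1 else 0)"
      by (intro sum.cong refl) (simp add: ind_def)
    thus ?thesis by (simp add: inner_vec_def sum.If_cases Int_def)
  qed
  \<comment> \<open>the first step of the filtration consists of the constants, as the pencil of \<open>{0}\<close> is everything\<close>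
  have orth_F1: "x \<bullet> w = 0" if x: "x \<bullet> ind Gen = 0" and w: "w \<in> lower_span 1" for x w
  proof -
    have "x \<bullet> ind (pencil U) = 0" if "U \<in> P" "vec.dim U < 1" for U
    proof -
      have "U = {0}" using that P_D(1)[of U] vec.subspace_0[of U] by auto
      thus ?thesis using x pencil0 by simp
    qed
    hence "{ind (pencil U) | U. U \<in> P \<and> vec.dim U < 1} \<subseteq> {w. x \<bullet> w = 0}" by blast
    moreover have "subspace {w. x \<bullet> w = 0}" by (rule subspace_hyperplane)
    ultimately show ?thesis using w span_minimal unfolding lower_span_def by blast
  qed
  have spectral: "- \<mu> * (x \<bullet> x) \<le> x \<bullet> disjointness x
      \<and> (x \<noteq> 0 \<longrightarrow> x \<bullet> disjointness x < \<mu> * (x \<bullet> x))"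
    if "x \<in> lower_span (Suc d)" "x \<bullet> ind Gen = 0" for x
  proof (rule filtered_selfadjoint_bounds[OF linear_disjointness disjointness_selfadjoint
        subspace_lower_span lower_span_mono _ disjointness_eigval, where n = d and \<mu> = \<mu> and x = x])
    show "lower_span 0 = {0}" by (simp add: lower_span_def)
  qed (use bounds orth_F1[OF that(2)] that(1) in auto)
  have span: "x \<in> lower_span (Suc d)" if "x \<in> span {ind Gen, ind Y, ind Z}" for x
  proof -
    have "{ind Gen, ind Y, ind Z} \<subseteq> lower_span (Suc d)"
      using ind_in_lower_span[of Gen] ind_in_lower_span[OF YZ(1)] ind_in_lower_span[OF YZ(2)] by simp
    from span_minimal[OF this subspace_lower_span] show ?thesis using that by (rule subsetD)
  qed
  have "ind Y = ind Z"
  proof (rule cross_ratio_bound_equality[OF linear_disjointness disjointness_selfadjoint,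
        where e = "ind Gen" and n = "real (card Gen)" and k = "real (opposite_count \<gamma> CARD('a) d)"
          and \<alpha> = "real (card Y)" and \<beta> = "real (card Z)" and b = b and \<mu> = \<mu>])
    show "ind Gen \<bullet> ind Gen = real (card Gen)" by (simp add: inner_ind)
    show "disjointness (ind Gen) = real (opposite_count \<gamma> CARD('a) d) *\<^sub>R ind Gen"
    proof -
      have "{g \<in> Gen. g \<inter> {0} = {0}} = Gen" using pencil0 by blast
      thus ?thesis using disjointness_pencil[OF zero_in_P] pencil0 by simp
    qed
    show "ind Y \<bullet> ind Y = real (card Y)" "ind Z \<bullet> ind Z = real (card Z)" by (simp_all add: inner_ind)
    show "ind Y \<bullet> ind Gen = real (card Y)" "ind Z \<bullet> ind Gen = real (card Z)"
      using YZ by (simp_all add: inner_ind Int_absorb2)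
    show "ind Y \<bullet> disjointness (ind Z) = 0"
    proof -
      have "disjointness (ind Z) $ y = 0" if y: "y \<in> Y" for y
      proof -
        have "z \<notin> Z" if "z \<inter> y = {0}" for z
          using meet[OF y, of z] that by (auto simp: Int_commute)
        thus ?thesis by (auto simp: disjointness_def ind_def intro!: sum.neutral)
      qed
      thus ?thesis by (auto simp: inner_vec_def ind_def intro!: sum.neutral)
    qed
    show "0 < real (card Gen)" using Gen_nonempty by (simp add: card_gt_0_iff)
    show "- \<mu> * (x \<bullet> x) \<le> x \<bullet> disjointness x"
      if "x \<in> span {ind Gen, ind Y, ind Z}" "x \<bullet> ind Gen = 0" for x
      using spectral[OF span[OF that(1)] that(2)] by simp
    show "x \<bullet> disjointness x < \<mu> * (x \<bullet> x)"
      if "x \<in> span {ind Gen, ind Y, ind Z}" "x \<bullet> ind Gen = 0" "x \<noteq> 0" for x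
      using spectral[OF span[OF that(1)] that(2)] that(3) by simp
  qed (fact pos ratio size)+
  thus ?thesis by (auto simp: ind_def vec_eq_iff split: if_splits)
qed

end

section \<open>Comparing the eigenvalues\<close>

lemma choose_two_add: "(a + c) choose 2 = (a choose 2) + (c choose 2) + a * c"
  by (induction c) (simp_all add: numeral_2_eq_2)

lemma signed_bounds:
  fixes M \<mu> :: real
  assumes "0 \<le> M" "0 < \<mu>" "M \<le> \<mu>" "even j \<Longrightarrow> M < \<mu>"
  shows "- \<mu> \<le> (-1) ^ j * M \<and> (-1) ^ j * M < \<mu>"
  using assms by (cases "even j") auto

context polar_space_form
begin

text \<open>For \<open>\<gamma> = 1\<close> the absolute value of the \<open>j\<close>-th eigenvalue is the valency divided by
  \<open>q ^ (j * (d - j))\<close>. So it is as large as the valency only for \<open>j = 0\<close> and \<open>j = d\<close>, and in the latter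
  case the eigenvalue is negative because \<open>d\<close> is odd. (Indeed the graph is then bipartite.)\<close>

lemma eigval_bounds_order_one:
  assumes "\<gamma> = 1" "odd d" and j: "1 \<le> j" "j \<le> d"
  defines "\<mu> \<equiv> real (opposite_count \<gamma> CARD('a) d)"
  shows "- \<mu> \<le> eigval j \<and> eigval j < \<mu>"
proof -
  let ?q = "real CARD('a)"
  define e where "e = (j choose 2) + ((d - j) choose 2)"
  have q: "1 < ?q" using two_le_card_field[where 'a='a] by simp
  have \<mu>: "\<mu> = ?q ^ (d choose 2)" by (simp add: \<mu>_def opposite_count_def assms(1))
  have eig: "eigval j = (-1) ^ j * ?q ^ e"
    unfolding eigval_def opposite_count_def by (simp add: assms(1) e_def power_add)
  have sum: "d choose 2 = e + j * (d - j)"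
    using choose_two_add[of j "d - j"] j by (simp add: e_def)
  show ?thesis unfolding eig
  proof (rule signed_bounds)
    show "?q ^ e \<le> \<mu>" unfolding \<mu> using q sum by (intro power_increasing) auto
    assume "even j"
    hence "j < d" using assms(2) j by (metis le_neq_implies_less)
    hence "e < d choose 2" using sum j by simp
    thus "?q ^ e < \<mu>" unfolding \<mu> using q by (intro power_strict_increasing) auto
  qed (use q \<mu> in auto)
qed

text \<open>With \<open>j = Suc a\<close> and \<open>d = Suc (a + k)\<close>, the ratio of the absolute values of the first and the
  \<open>j\<close>-th eigenvalue is \<open>(\<gamma> / q) ^ a * q ^ (a * k)\<close>, which is at least 1. The first eigenvalue
  is negative, so a positive one of the same size has \<open>a > 0\<close>, hence \<open>k = 0\<close> and \<open>\<gamma> = q\<close>. This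
  concerns the last eigenvalue, which is positive only for even \<open>d\<close>.\<close>

lemma eigval_bounds_order_ge_q:
  assumes \<gamma>: "CARD('a) \<le> \<gamma>" "\<gamma> = CARD('a) \<Longrightarrow> odd d" and j: "1 \<le> j" "j \<le> d"
  defines "\<mu> \<equiv> real (opposite_count \<gamma> CARD('a) (d - 1))"
  shows "- \<mu> \<le> eigval j \<and> eigval j < \<mu>"
proof -
  let ?q = "real CARD('a)" and ?g = "real \<gamma>"
  define a k where "a = j - 1" and "k = d - j"
  have jd: "j = Suc a" "d - 1 = a + k" "d - j = k" using j by (auto simp: a_def k_def)
  have q: "1 < ?q" "?q \<le> ?g" using two_le_card_field[where 'a='a] \<gamma> by auto
  \<comment> \<open>the common factor of the two eigenvalues to be compared\<close>
  define R where "R = ?q ^ ((a choose 2) + (k choose 2)) * ?g ^ k"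
  have R: "0 < R" using q by (simp add: R_def)
  have \<mu>: "\<mu> = R * (?g ^ a * ?q ^ (a * k))"
    unfolding \<mu>_def opposite_count_def jd by (simp add: choose_two_add power_add R_def)
  have eig: "eigval j = (-1) ^ j * (R * ?q ^ a)"
    unfolding eigval_def opposite_count_def jd(3) unfolding jd(1) by (simp add: R_def power_add numeral_2_eq_2)
  have ga: "?q ^ a \<le> ?g ^ a" using q by (intro power_mono) auto
  have ak: "1 \<le> ?q ^ (a * k)" using q by (intro one_le_power) auto
  have le: "?q ^ a \<le> ?g ^ a * ?q ^ (a * k)" using mult_mono[OF ga ak] q by simp
  show ?thesis unfolding eig
  proof (rule signed_bounds)
    show "R * ?q ^ a \<le> \<mu>" unfolding \<mu> using le R by simp
    assume "even j"
    hence a: "0 < a" using jd by (cases a) auto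
    have "?q ^ a < ?g ^ a * ?q ^ (a * k)"
    proof (cases "k = 0")
      case True
      hence "j = d" using j by (simp add: k_def)
      hence "\<gamma> \<noteq> CARD('a)" using \<gamma>(2) \<open>even j\<close> by auto
      hence "?q ^ a < ?g ^ a" using q a by (intro power_strict_mono) auto
      thus ?thesis using True by simp
    next
      case False
      hence "1 < ?q ^ (a * k)" using q a by (intro one_less_power) auto
      hence "?q ^ a * 1 < ?g ^ a * ?q ^ (a * k)" using ga q by (intro mult_le_less_imp_less) auto
      thus ?thesis by simp
    qed
    thus "R * ?q ^ a < \<mu>" unfolding \<mu> using R by simp
  qed (use R q \<mu> in auto)
qed

lemma opposite_count_pos: "0 < \<gamma> \<Longrightarrow> 0 < opposite_count \<gamma> CARD('a) k"
  by (simp add: opposite_count_def)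

text \<open>Here \<open>\<mu>\<close> is the valency, the absolute value of the last eigenvalue.\<close>

lemma equality_half:
  assumes "\<gamma> = 1" "odd d" "cross_intersecting_EKR_set P Y Z"
    and "sqrt (real (card Y) * real (card Z)) = real (card Gen) / 2"
  shows "Y = Z"
proof (rule cross_intersecting_equality[OF assms(3,4)])
  show "0 < real (card Gen) / 2" using Gen_nonempty by (simp add: card_gt_0_iff)
  show "0 < real (opposite_count \<gamma> CARD('a) d)" using assms(1) opposite_count_pos by simp
  show "- real (opposite_count \<gamma> CARD('a) d) \<le> eigval j \<and> eigval j < real (opposite_count \<gamma> CARD('a) d)"
    if "1 \<le> j" "j \<le> d" for j
    using eigval_bounds_order_one[OF assms(1,2) that] .
qed simp

text \<open>Here \<open>\<mu>\<close> is the absolute value of the first eigenvalue, and the relation between \<open>\<mu>\<close> and the size of a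
  pencil is \<open>pencil_double_count\<close>.\<close>

lemma equality_pencil:
  assumes "CARD('a) \<le> \<gamma>" "\<gamma> = CARD('a) \<Longrightarrow> odd d" "cross_intersecting_EKR_set P Y Z"
    and p: "p \<in> points P"
    and size: "sqrt (real (card Y) * real (card Z)) = real (card {g \<in> Gen. p \<subseteq> g})"
  shows "Y = Z"
proof (rule cross_intersecting_equality[OF assms(3) size])
  have \<gamma>: "0 < \<gamma>" using assms(1) two_le_card_field[where 'a='a] by simp
  have "p \<in> P" using p by (simp add: points_def)
  then obtain g where "g \<in> Gen" "p \<subseteq> g" by (rule Gen_above)
  thus "0 < real (card {g \<in> Gen. p \<subseteq> g})" by (auto simp: card_gt_0_iff)
  show "0 < real (opposite_count \<gamma> CARD('a) (d - 1))" using opposite_count_pos[OF \<gamma>] by simp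
  have "card {g \<in> Gen. p \<subseteq> g} \<le> card Gen" by (intro card_mono) auto
  hence "real (card Gen) - real (card {g \<in> Gen. p \<subseteq> g}) = real (card Gen - card {g \<in> Gen. p \<subseteq> g})"
    by (simp add: of_nat_diff)
  thus "real (opposite_count \<gamma> CARD('a) d) * real (card {g \<in> Gen. p \<subseteq> g})
      = real (opposite_count \<gamma> CARD('a) (d - 1)) * (real (card Gen) - real (card {g \<in> Gen. p \<subseteq> g}))"
    using pencil_double_count[OF p] by (simp only: of_nat_mult[symmetric] mult.commute)
  show "- real (opposite_count \<gamma> CARD('a) (d - 1)) \<le> eigval j
      \<and> eigval j < real (opposite_count \<gamma> CARD('a) (d - 1))"
    if "1 \<le> j" "j \<le> d" for j
    using eigval_bounds_order_ge_q[OF assms(1,2) that] .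
qed

end

section \<open>The classical polar spaces\<close>

text \<open>On a line \<open>v + t *s u\<close> with \<open>u\<close> singular, \<open>Q\<close> is an affine function of \<open>t\<close>, so \<open>c = 1\<close>.\<close>

lemma quadric_polar_space_form:
  fixes Q :: "'a::{field,finite} ^ 'n \<Rightarrow> 'a"
  assumes Q: "nondegenerate_quadratic_form Q" and P: "P = singular_subspaces Q"
    and dim: "CARD('n) = 2 * polar_rank P + m"
  shows "polar_space_form (polar_form Q) {u. Q u = 0} P 1 m (CARD('a) ^ m)"
proof -
  have scale: "Q (c *s u) = c\<^sup>2 * Q u" for c u
    using Q by (simp add: nondegenerate_quadratic_form_def quadratic_form_def)
  have bil: "bilinear_form (polar_form Q)"
    using Q by (simp add: nondegenerate_quadratic_form_def quadratic_form_def)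
  have sym: "polar_form Q u v = polar_form Q v u" for u v
    by (simp add: polar_form_def add.commute)
  have Q_add: "Q (u + v) = Q u + Q v + polar_form Q u v" for u v
    by (simp add: polar_form_def)
  have pscale: "polar_form Q u (k *s v) = k * polar_form Q u v" for u k v
    using bil by (simp add: bilinear_form_def Vector_Spaces.linear_iff)
  show ?thesis
  proof (rule polar_space_form.intro)
    show "Vector_Spaces.linear (*s) (*) (\<lambda>u. polar_form Q u v)" for v
      using bil by (simp add: bilinear_form_def)
    show "polar_form Q v u = 0" if "polar_form Q u v = 0" for u v using that sym by simp
    show "0 \<in> {u. Q u = 0}" using scale[of 0 0] by simp
    show "k *s u \<in> {u. Q u = 0}" if "u \<in> {u. Q u = 0}" for k u using that scale by simp
    show "u + v \<in> {u. Q u = 0}"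
      if "u \<in> {u. Q u = 0}" "v \<in> {u. Q u = 0}" "polar_form Q u v = 0" for u v
      using that by (simp add: Q_add)
    show "polar_form Q u u = 0" if "u \<in> {u. Q u = 0}" for u
    proof -
      have "u + u = 2 *s u" by (simp add: vec_eq_iff)
      thus ?thesis using that scale[of 2 u] by (simp add: polar_form_def)
    qed
    show "\<exists>v. polar_form Q v u \<noteq> 0" if "u \<in> {u. Q u = 0}" "u \<noteq> 0" for u
      using Q that sym by (auto simp: nondegenerate_quadratic_form_def)
    show "card {t. v + t *s u \<in> {u. Q u = 0}} = 1"
      if "u \<in> {u. Q u = 0}" "polar_form Q v u \<noteq> 0" for u v
    proof -
      have "Q (v + t *s u) = 0 \<longleftrightarrow> t = - Q v / polar_form Q v u" for t
        using that by (simp add: Q_add scale pscale field_simps eq_neg_iff_add_eq_0 add.commute)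
      thus ?thesis by simp
    qed
    show "P = {U. vec.subspace U \<and> U \<subseteq> {u. Q u = 0} \<and> (\<forall>u\<in>U. \<forall>v\<in>U. polar_form Q u v = 0)}"
      unfolding P singular_subspaces_def by (auto simp: polar_form_def vec.subspace_add subset_iff)
    show "CARD('n) = 2 * polar_rank P + m" by (fact dim)
  qed simp
qed

text \<open>Every vector is isotropic, so a line contains \<open>c = q\<close> isotropic vectors.\<close>

lemma alternating_polar_space_form:
  fixes B :: "'a::{field,finite} ^ 'n \<Rightarrow> 'a ^ 'n \<Rightarrow> 'a"
  assumes B: "alternating_form B" "nondegenerate_form B" and P: "P = isotropic_subspaces B"
    and dim: "CARD('n) = 2 * polar_rank P"
  shows "polar_space_form B UNIV P CARD('a) 0 CARD('a)"
proof -
  have bil: "bilinear_form B" and alt: "B u u = 0" for u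
    using B by (auto simp: alternating_form_def)
  have add: "B (u + v) w = B u w + B v w" "B w (u + v) = B w u + B w v" for u v w
    using bil by (simp_all add: bilinear_form_def Vector_Spaces.linear_iff)
  have skew: "B u v = - B v u" for u v
    using alt[of "u + v"] alt[of u] alt[of v] by (simp add: add eq_neg_iff_add_eq_0 add.commute)
  show ?thesis
  proof (rule polar_space_form.intro)
    show "Vector_Spaces.linear (*s) (*) (\<lambda>u. B u v)" for v
      using bil by (simp add: bilinear_form_def)
    show "B v u = 0" if "B u v = 0" for u v using that skew[of v u] by simp
    show "\<exists>v. B v u \<noteq> 0" if u: "u \<noteq> 0" for u
    proof -
      obtain v where "B u v \<noteq> 0" using B(2) u by (auto simp: nondegenerate_form_def)
      thus ?thesis using skew[of v u] by (intro exI[of _ v]) simp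
    qed
    show "P = {U. vec.subspace U \<and> U \<subseteq> UNIV \<and> (\<forall>u\<in>U. \<forall>v\<in>U. B u v = 0)}"
      unfolding P isotropic_subspaces_def by simp
    show "CARD('n) = 2 * polar_rank P + 0" using dim by simp
  qed (simp_all add: alt)
qed

text \<open>Polynomials of degree \<open>r\<close> have at most \<open>r\<close> roots. For \<open>CARD('a) = r\<^sup>2\<close> the first set is a fibre
  of the trace and the second one the subfield of order \<open>r\<close>.\<close>

lemma card_roots_trace_le:
  fixes a :: "'a::{field,finite}"
  assumes "2 \<le> r"
  shows "card {s. s ^ r + s = a} \<le> r" and "card {s::'a. s ^ r = s} \<le> r"
proof -
  have "card {s. s ^ r + k * s = a} \<le> r" for k a :: 'a
  proof -
    define p where "p = monom 1 r + [:- a, k:]"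
    have deg: "degree p = r"
      unfolding p_def using assms
      by (subst degree_add_eq_left) (auto simp: degree_monom_eq intro: le_less_trans[OF degree_pCons_le])
    hence "p \<noteq> 0" using assms by auto
    hence "card {s. poly p s = 0} \<le> r" using card_poly_roots_bound[of p] deg by simp
    moreover have "poly p s = 0 \<longleftrightarrow> s ^ r + k * s = a" for s
      by (simp add: p_def poly_monom algebra_simps)
    ultimately show ?thesis by simp
  qed
  from this[of 1 a] this[of "-1" 0] show "card {s. s ^ r + s = a} \<le> r" "card {s::'a. s ^ r = s} \<le> r"
    by simp_all
qed

text \<open>A map from \<open>r * r\<close> points to at most \<open>r\<close> points with fibres of size at most \<open>r\<close> leaves no room for a
  smaller fibre.\<close>

lemma card_fibre_eq:
  fixes f :: "'b::finite \<Rightarrow> 'c::finite"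
  assumes "CARD('b) = r * r" and range: "\<And>x. f x \<in> F" and "card F \<le> r"
    and fibres: "\<And>y. card {x. f x = y} \<le> r" and y: "y \<in> F"
  shows "card {x. f x = y} = r"
proof -
  have "r * r = (\<Sum>y\<in>F. card {x. f x = y})"
  proof -
    have "CARD('b) = card (\<Union>y\<in>F. {x. f x = y})" using range by (intro arg_cong[of _ _ card]) auto
    also have "\<dots> = (\<Sum>y\<in>F. card {x. f x = y})" by (intro card_UN_disjoint) auto
    finally show ?thesis using assms(1) by simp
  qed
  also have "\<dots> = card {x. f x = y} + (\<Sum>y\<in>F - {y}. card {x. f x = y})"
    using y by (simp add: sum.remove)
  also have "\<dots> \<le> card {x. f x = y} + (card F - 1) * r"
  proof -
    have "(\<Sum>y\<in>F - {y}. card {x. f x = y}) \<le> of_nat (card (F - {y})) * r"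
      using fibres by (intro sum_bounded_above) auto
    thus ?thesis using y by simp
  qed
  also have "\<dots> \<le> card {x. f x = y} + (r - 1) * r"
    using assms(3) by (intro add_left_mono mult_right_mono diff_le_mono) auto
  finally have "r * r - (r - 1) * r \<le> card {x. f x = y}" by simp
  moreover have "r * r - (r - 1) * r = r" by (cases r) auto
  ultimately show ?thesis using fibres[of y] by simp
qed

text \<open>A line \<open>v + t *s u\<close> with \<open>u\<close> isotropic and not perpendicular to \<open>v\<close> contains exactly \<open>r\<close>
  isotropic vectors: the value of the form is \<open>s ^ r + s - h v v\<close> for \<open>s = h v v + t * h u v\<close>, it lies in the subfield of order \<open>r\<close> because \<open>h w w = h w w ^ r\<close>, and so all its fibres
  over this subfield have the same size \<open>r\<close>, by \<open>card_fibre_eq\<close>.\<close>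

lemma hermitian_polar_space_form:
  fixes h :: "'a::{field,finite} ^ 'n \<Rightarrow> 'a ^ 'n \<Rightarrow> 'a"
  assumes h: "hermitian_form r h" "nondegenerate_form h" and P: "P = isotropic_subspaces h"
    and dim: "CARD('n) = 2 * polar_rank P + m"
  shows "polar_space_form h {u. h u u = 0} P r m (r * CARD('a) ^ m)"
proof -
  have card: "CARD('a) = r * r"
    using h(1) unfolding hermitian_form_def power2_eq_square by blast
  have lin: "Vector_Spaces.linear (*s) (*) (\<lambda>u. h u v)" and conj: "h v u = h u v ^ r" for u v
    using h(1) unfolding hermitian_form_def by blast+
  have add: "h (u + v) w = h u w + h v w" and scale: "h (k *s u) w = k * h u w" for u v w k
    using lin[of w] by (simp_all add: Vector_Spaces.linear_iff)
  have r: "2 \<le> r"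
  proof (rule ccontr)
    assume "\<not> 2 \<le> r"
    hence "r = 0 \<or> r = 1" by auto
    thus False using card two_le_card_field[where 'a='a] by auto
  qed
  have refl: "h v u = 0" if "h u v = 0" for u v using conj[of v u] that r by simp
  show ?thesis
  proof (rule polar_space_form.intro)
    show "Vector_Spaces.linear (*s) (*) (\<lambda>u. h u v)" for v by (rule lin)
    show "h v u = 0" if "h u v = 0" for u v using refl[OF that] .
    show "0 \<in> {u. h u u = 0}" using scale[of 0 0 0] by simp
    show "k *s u \<in> {u. h u u = 0}" if "u \<in> {u. h u u = 0}" for k u
      using that refl[of "k *s u" u] by (simp add: scale)
    show "u + v \<in> {u. h u u = 0}"
      if "u \<in> {u. h u u = 0}" "v \<in> {u. h u u = 0}" "h u v = 0" for u v
    proof -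
      have "h (u + v) u = 0" "h (u + v) v = 0" using that refl by (simp_all add: add)
      hence "h u (u + v) = 0" "h v (u + v) = 0" using refl by blast+
      thus ?thesis by (simp add: add)
    qed
    show "h u u = 0" if "u \<in> {u. h u u = 0}" for u using that by simp
    show "\<exists>v. h v u \<noteq> 0" if "u \<in> {u. h u u = 0}" and u: "u \<noteq> 0" for u
    proof -
      obtain v where "h u v \<noteq> 0" using h(2) u unfolding nondegenerate_form_def by blast
      thus ?thesis using refl by blast
    qed
    show "card {t. v + t *s u \<in> {u. h u u = 0}} = r"
      if u: "u \<in> {u. h u u = 0}" and vu: "h v u \<noteq> 0" for u v
    proof -
      let ?f = "\<lambda>t. h (v + t *s u) (v + t *s u)"
      have uv: "h u v \<noteq> 0" using vu refl by blast
      have f: "?f t = (h v v + t * h u v) ^ r + t * h u v" for t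
      proof -
        have "?f t = h v (v + t *s u) + t * h u (v + t *s u)" by (simp add: add scale)
        also have "h v (v + t *s u) = h (v + t *s u) v ^ r" by (rule conj)
        also have "h u (v + t *s u) = h (v + t *s u) u ^ r" by (rule conj)
        also have "h (v + t *s u) u = h v u" using u by (simp add: add scale)
        also have "h v u ^ r = h u v" by (rule conj[symmetric])
        finally show ?thesis by (simp add: add scale)
      qed
      have "card {t. ?f t = y} \<le> r" for y
      proof -
        have "card {t. ?f t = y} \<le> card {s. s ^ r + s = y + h v v}"
          by (rule card_inj_on_le[of "\<lambda>t. h v v + t * h u v"])
             (use uv in \<open>auto simp: inj_on_def f\<close>)
        also have "\<dots> \<le> r" by (rule card_roots_trace_le[OF r])
        finally show ?thesis .
      qed
      hence "card {t. ?f t = 0} = r"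
        using card card_roots_trace_le(2)[OF r] r conj[symmetric]
        by (intro card_fibre_eq[where F = "{s. s ^ r = s}"]) auto
      thus ?thesis by simp
    qed
    show "P = {U. vec.subspace U \<and> U \<subseteq> {u. h u u = 0} \<and> (\<forall>u\<in>U. \<forall>v\<in>U. h u v = 0)}"
      unfolding P isotropic_subspaces_def by auto
    show "CARD('n) = 2 * polar_rank P + m" by (fact dim)
  qed simp
qed

theorem corollary5p2:
  fixes P :: "('a::{field,finite} ^ 'n) set set"
    and Y Z :: "('a ^ 'n) set set"
    and d n :: nat and b :: real
  assumes "(hyperbolic_quadric d P \<and> odd d) \<or> (parabolic_quadric d P \<and> odd d) \<or>
           (symplectic_space d P \<and> odd d) \<or> even_hermitian_space d P \<or> elliptic_quadric d P"
    and "n = card (generators P)"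
    and "if hyperbolic_quadric d P then b = real n / 2
         else \<exists>p \<in> points P. b = real (card {g \<in> generators P. p \<subseteq> g})"
    and "cross_intersecting_EKR_set P Y Z"
    and "sqrt (real (card Y) * real (card Z)) = b"
  shows "Y = Z \<and> EKR_set P Y"
proof -
  have "Y = Z"
  proof (cases "hyperbolic_quadric d P")
    case True
    hence "odd d"
      using assms(1) by (auto simp: hyperbolic_quadric_def parabolic_quadric_def
          symplectic_space_def even_hermitian_space_def elliptic_quadric_def)
    obtain Q where Q: "nondegenerate_quadratic_form Q" "P = singular_subspaces Q"
      and d: "CARD('n) = 2 * polar_rank P + 0" "polar_rank P = d"
      using True by (auto simp: hyperbolic_quadric_def quadric_def)
    interpret polar_space_form "polar_form Q" "{u. Q u = 0}" P 1 0 "CARD('a) ^ 0"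
      using Q d(1) by (rule quadric_polar_space_form)
    show ?thesis
      using equality_half[OF _ _ assms(4)] assms(2,3,5) True \<open>odd d\<close> d(2) by simp
  next
    case False
    then obtain p where p: "p \<in> points P"
      and size: "sqrt (real (card Y) * real (card Z)) = real (card {g \<in> generators P. p \<subseteq> g})"
      using assms(3,5) by auto
    have q: "2 \<le> CARD('a)" by (rule two_le_card_field)
    have quadric_case: ?thesis
      if m: "quadric P" "CARD('n) = 2 * polar_rank P + m" "1 \<le> m" "m = 1 \<Longrightarrow> odd (polar_rank P)" for m
    proof -
      obtain Q where Q: "nondegenerate_quadratic_form Q" "P = singular_subspaces Q"
        using m(1) by (auto simp: quadric_def)
      interpret polar_space_form "polar_form Q" "{u. Q u = 0}" P 1 m "CARD('a) ^ m"
        using Q m(2) by (rule quadric_polar_space_form)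
      have "CARD('a) ^ 1 \<le> CARD('a) ^ m" using q m(3) by (intro power_increasing) auto
      moreover have "m = 1" if "CARD('a) ^ m = CARD('a)"
        using power_inject_exp[of "CARD('a)" m 1] q that by simp
      ultimately show ?thesis
        using m(4) by (intro equality_pencil[OF _ _ assms(4) p size]) auto
    qed
    consider "parabolic_quadric d P" "odd d" | "symplectic_space d P" "odd d"
      | "even_hermitian_space d P" | "elliptic_quadric d P"
      using assms(1) False by blast
    thus ?thesis
    proof cases
      case 1
      thus ?thesis by (intro quadric_case[of 1]) (auto simp: parabolic_quadric_def)
    next
      case 4
      thus ?thesis by (intro quadric_case[of 2]) (auto simp: elliptic_quadric_def)
    next
      case 2
      then obtain B where "alternating_form B" "nondegenerate_form B" "P = isotropic_subspaces B"
        and "CARD('n) = 2 * polar_rank P" and d: "polar_rank P = d"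
        by (auto simp: symplectic_space_def)
      then interpret polar_space_form B UNIV P "CARD('a)" 0 "CARD('a)"
        by (intro alternating_polar_space_form)
      show ?thesis using 2 d by (intro equality_pencil[OF _ _ assms(4) p size]) auto
    next
      case 3
      then obtain r h where h: "hermitian_form r h" "nondegenerate_form h" "P = isotropic_subspaces h"
        and dim: "CARD('n) = 2 * polar_rank P + 1"
        by (auto simp: even_hermitian_space_def)
      interpret polar_space_form h "{u. h u u = 0}" P r 1 "r * CARD('a) ^ 1"
        using h dim by (rule hermitian_polar_space_form)
      have "CARD('a) = r\<^sup>2" using h(1) by (simp add: hermitian_form_def)
      hence "2 \<le> r\<^sup>2" using q by simp
      hence "r \<noteq> 0" "r \<noteq> 1" by (intro notI; simp)+
      hence "1 < r" by linarith
      thus ?thesis using q by (intro equality_pencil[OF _ _ assms(4) p size]) auto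
    qed
  qed
  thus ?thesis
    using assms(4) by (auto simp: EKR_set_def cross_intersecting_EKR_set_def)
qed

end
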